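(* (Brunn–Minkowski inequality) Let $(X,d_X,m_X)$ be a metric measure space with $\operatorname{supp}m_X=X$ that satisfies $CD(k,N)$ for a lower semicontinuous $k:X\to\mathbb R$ and $N\ge1$. Let $A_0,A_1\subset X$ be bounded Borel sets with $m_X(A_0)m_X(A_1)>0$. Set $\mathcal G(A_0,A_1)=\{\gamma\in\mathcal G(X):\gamma(i)\in A_i,\ i=0,1\}$ and, for $t\in[0,1]$, $A_t=\{\gamma(t):\gamma\in\mathcal G(A_0,A_1)\}$. Then for every $t\in[0,1]$ $$m_X(A_t)^{1/N}\ \ge\ \inf_{\gamma\in\mathcal G(A_0,A_1)}\tau^{(1-t)}_{k^-_\gamma,N}(|\dot\gamma|)\;m_X(A_0)^{1/N}+\inf_{\gamma\in\mathcal G(A_0,A_1)}\tau^{(t)}_{k^+_\gamma,N}(|\dot\gamma|)\;m_X(A_1)^{1/N},$$ where both infima are $\ge0$.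
   Context: A metric measure space $(X,d_X,m_X)$ is a complete separable metric space $(X,d_X)$ with a Borel measure $m_X$ such that for every $x\in X$ there is $r>0$ with $m_X(B_r(x))\in(0,\infty)$; also $m_X(X)\ne 0$. A geodesic is a distance-minimizing curve $\gamma:[0,1]\to X$ of constant speed; $|\dot\gamma|$ denotes its speed, i.e. its length. $\mathcal G(X)$ is the set of geodesics with the sup-distance, and $e_t(\gamma)=\gamma(t)$. $\mathcal P_2(X)$ is the set of Borel probability measures with finite second moment, with the $L^2$-Wasserstein distance, and $\mathcal P_2(X,m_X)$ is the subset of $m_X$-absolutely continuous ones. A dynamical optimal coupling of $\mu_0,\mu_1$ is a probability measure $\Pi$ on $\mathcal G(X)$ such that $(e_0,e_1)_*\Pi$ is an optimal coupling (for the cost $d_X^2$) of $\mu_0,\mu_1$. Distortion coefficients. For $\theta>0$ and continuous $\kappa:[0,\theta]\to\mathbb R$ let $\mathfrak s_\kappa$ be the solution of $u''+\kappa u=0$, $u(0)=0$, $u'(0)=1$. For $t\in[0,1]$ put $\sigma^{(t)}_\kappa(\theta)=\mathfrak s_\kappa(t\theta)/\mathfrak s_\kappa(\theta)$ if $\mathfrak s_\kappa>0$ on $(0,\theta]$, and $\sigma^{(t)}_\kappa(\theta)=\infty$ otherwise. For lower semicontinuous $\kappa:[0,\theta]\to\mathbb R$ put $\kappa_n(s)=\inf_{r\in[0,\theta]}\{\kappa(r)+n|s-r|\}$ and $\sigma^{(t)}_\kappa(\theta)=\lim_{n\to\infty}\sigma^{(t)}_{\kappa_n}(\theta)\in[0,\infty]$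 (consistent for continuous $\kappa$). Put $\sigma_\kappa^{(t)}(0)=t$. For lower semicontinuous $k:X\to\mathbb R$ and a geodesic $\gamma$ with $\theta=|\dot\gamma|$ let $\bar\gamma:[0,\theta]\to X$ be its unit speed reparametrization, $k^+_\gamma=k_\gamma=k\circ\bar\gamma$ and $k^-_\gamma(s)=k_\gamma(\theta-s)$. For $N>0$ set $\sigma^{(t)}_{k^\pm_\gamma,N}(\theta)=\sigma^{(t)}_{k^\pm_\gamma/N}(\theta)$. For $N>1$ set $\tau^{(t)}_{k^\pm_\gamma,N}(\theta)=t^{1/N}\big[\sigma^{(t)}_{k^\pm_\gamma,N-1}(\theta)\big]^{(N-1)/N}$; for $N=1$ set $\tau^{(t)}_{k_\gamma^\pm,1}(\theta)=\theta\cdot\infty$ if $k_\gamma>0$ and $=t$ otherwise. Conventions: $r\cdot\infty=\infty$ for $r>0$, $0\cdot\infty=0$, $\infty^\alpha=\infty$ for $\alpha>0$. Condition $CD(k,N)$, $N\ge1$. For $\nu=\varrho m_X+\nu^s$ (Lebesgue decomposition) let $S_N(\nu)=-\int_X\varrho^{1-1/N}\,dm_X$. $(X,d_X,m_X)$ satisfies $CD(k,N)$ if for each pair $\nu_0=\varrho_0m_X,\nu_1=\varrho_1m_X\in\mathcal P_2(X,m_X)$ with bounded support there exist a dynamical optimal coupling $\Pi$ of $\nu_0,\nu_1$ and a geodesic $(\nu_t)_{t\in[0,1]}\subset\mathcal P_2(X,m_X)$ from $\nu_0$ to $\nu_1$ such that $$S_{N'}(\nu_t)\le-\int\Big[\tau^{(1-t)}_{k^-_\gamma,N'}(|\dot\gamma|)\varrho_0(\gamma(0))^{-1/N'}+\tau^{(t)}_{k^+_\gamma,N'}(|\dot\gamma|)\varrho_1(\gamma(1))^{-1/N'}\Big]d\Pi(\gamma)$$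 for all $t\in[0,1]$ and all $N'\ge N$. *)

theory Defs
  imports "HOL-Probability.Probability"
begin

section \<open>Powers of extended nonnegative numbers\<close>

text \<open>
  Real powers on \<open>[0,\<infinity>]\<close>, with \<open>\<infinity>\<^sup>a = \<infinity>\<close> for \<open>a > 0\<close>. As for \<^const>\<open>powr\<close>, \<open>0\<close> to the power \<open>0\<close>
  is \<open>0\<close>; this is what makes the entropy for \<open>N = 1\<close> equal to minus the mass of the set where the
  density is positive. The product on \<^typ>\<open>ennreal\<close> already satisfies \<open>0 * \<infinity> = 0\<close>.
\<close>

definition epow :: "ennreal \<Rightarrow> real \<Rightarrow> ennreal" where
  "epow x a =
     (if x = top then (if a < 0 then 0 else if a = 0 then 1 else top)
      else if x = 0 \<and> a < 0 then top
      else ennreal (enn2real x powr a))"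


section \<open>Metric measure spaces\<close>

definition msupp :: "'a::topological_space measure \<Rightarrow> 'a set" where
  "msupp M = {x. \<forall>U. open U \<longrightarrow> x \<in> U \<longrightarrow> 0 < emeasure M U}"

definition metric_measure_space :: "'a::polish_space measure \<Rightarrow> bool" where
  "metric_measure_space M \<longleftrightarrow>
     sets M = sets borel \<and>
     (\<forall>x. \<exists>r>0. 0 < emeasure M (ball x r) \<and> emeasure M (ball x r) < top) \<and>
     emeasure M UNIV \<noteq> 0"

definition lower_semicontinuous :: "('a::topological_space \<Rightarrow> real) \<Rightarrow> bool" where
  "lower_semicontinuous f \<longleftrightarrow> (\<forall>a. open {x. a < f x})"


section \<open>Geodesics\<close>

text \<open>
  Used for curves of points, with \<^const>\<open>dist\<close>, and for curves of measures, with the Wasserstein distance.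
\<close>

definition constant_speed_geodesic :: "('b \<Rightarrow> 'b \<Rightarrow> real) \<Rightarrow> (real \<Rightarrow> 'b) \<Rightarrow> bool" where
  "constant_speed_geodesic d \<gamma> \<longleftrightarrow>
     (\<forall>s\<in>{0..1}. \<forall>t\<in>{0..1}. d (\<gamma> s) (\<gamma> t) = \<bar>s - t\<bar> * d (\<gamma> 0) (\<gamma> 1))"

text \<open>
  Curves on \<open>[0,1]\<close> are represented by functions that are \<^const>\<open>undefined\<close> off \<open>[0,1]\<close>. The
  sup-distance is that of \<^const>\<open>cfunspace\<close>.
\<close>

definition geodesics :: "(real \<Rightarrow> 'a::metric_space) set" where
  "geodesics = {\<gamma> \<in> extensional {0..1}. constant_speed_geodesic dist \<gamma>}"

definition geodesic_metric :: "(real \<Rightarrow> 'a::metric_space) metric" where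
  "geodesic_metric = submetric (cfunspace (top_of_set {0..1}) euclidean_metric) geodesics"

definition geodesic_borel :: "(real \<Rightarrow> 'a::metric_space) measure" where
  "geodesic_borel = sigma geodesics {U. openin (mtopology_of geodesic_metric) U}"

definition speed :: "(real \<Rightarrow> 'a::metric_space) \<Rightarrow> real" where
  "speed \<gamma> = dist (\<gamma> 0) (\<gamma> 1)"

definition geodesics_between :: "'a::metric_space set \<Rightarrow> 'a set \<Rightarrow> (real \<Rightarrow> 'a) set" where
  "geodesics_between A B = {\<gamma> \<in> geodesics. \<gamma> 0 \<in> A \<and> \<gamma> 1 \<in> B}"

text \<open>
  For Borel sets \<open>A\<close>, \<open>B\<close> the following set is analytic, but it need not be Borel, and \<^const>\<open>emeasure\<close> is
  \<open>0\<close> on non-measurable sets. Its mass is therefore taken with \<^const>\<open>outer_measure_of\<close>, which agrees with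
  the completed measure on analytic sets.
\<close>

definition intermediate_points :: "'a::metric_space set \<Rightarrow> 'a set \<Rightarrow> real \<Rightarrow> 'a set" where
  "intermediate_points A B t = {\<gamma> t | \<gamma>. \<gamma> \<in> geodesics_between A B}"


section \<open>Optimal transport\<close>

definition P2 :: "'a::polish_space measure set" where
  "P2 = {\<mu>. prob_space \<mu> \<and> sets \<mu> = sets borel \<and>
            (\<exists>x\<^sub>0. (\<integral>\<^sup>+ x. ennreal ((dist x\<^sub>0 x)\<^sup>2) \<partial>\<mu>) < top)}"

definition P2_ac :: "'a::polish_space measure \<Rightarrow> 'a measure set" where
  "P2_ac M = {\<mu> \<in> P2. absolutely_continuous M \<mu>}"

definition couplings ::
    "'a::polish_space measure \<Rightarrow> 'a measure \<Rightarrow> ('a \<times> 'a) measure set" where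
  "couplings \<mu> \<nu> =
     {\<pi>. sets \<pi> = sets borel \<and> distr \<pi> borel fst = \<mu> \<and> distr \<pi> borel snd = \<nu>}"

definition transport_cost :: "('a::polish_space \<times> 'a) measure \<Rightarrow> ennreal" where
  "transport_cost \<pi> = (\<integral>\<^sup>+ p. ennreal ((dist (fst p) (snd p))\<^sup>2) \<partial>\<pi>)"

definition optimal_coupling ::
    "('a::polish_space \<times> 'a) measure \<Rightarrow> 'a measure \<Rightarrow> 'a measure \<Rightarrow> bool" where
  "optimal_coupling \<pi> \<mu> \<nu> \<longleftrightarrow>
     \<pi> \<in> couplings \<mu> \<nu> \<and> (\<forall>\<pi>'\<in>couplings \<mu> \<nu>. transport_cost \<pi> \<le> transport_cost \<pi>')"

definition W2 :: "'a::polish_space measure \<Rightarrow> 'a measure \<Rightarrow> real" where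
  "W2 \<mu> \<nu> = sqrt (enn2real (INF \<pi>\<in>couplings \<mu> \<nu>. transport_cost \<pi>))"

definition dynamical_optimal_coupling ::
    "(real \<Rightarrow> 'a::polish_space) measure \<Rightarrow> 'a measure \<Rightarrow> 'a measure \<Rightarrow> bool" where
  "dynamical_optimal_coupling \<Theta> \<mu> \<nu> \<longleftrightarrow>
     prob_space \<Theta> \<and> sets \<Theta> = sets geodesic_borel \<and>
     optimal_coupling (distr \<Theta> borel (\<lambda>\<gamma>. (\<gamma> 0, \<gamma> 1))) \<mu> \<nu>"


section \<open>Distortion coefficients\<close>

text \<open>
  The function \<open>\<s>\<^sub>\<kappa>\<close> on \<open>[0,\<theta>]\<close>: the solution of \<open>u'' + \<kappa> u = 0\<close>, \<open>u 0 = 0\<close>, \<open>u' 0 = 1\<close>. Derivatives are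
  one-sided at the end points, and values off \<open>[0,\<theta>]\<close> are fixed to make the solution unique.
\<close>

definition is_sn :: "(real \<Rightarrow> real) \<Rightarrow> real \<Rightarrow> (real \<Rightarrow> real) \<Rightarrow> bool" where
  "is_sn \<kappa> \<theta> u \<longleftrightarrow> u \<in> extensional {0..\<theta>} \<and> u 0 = 0 \<and>
     (\<exists>u'. u' 0 = 1 \<and>
       (\<forall>s\<in>{0..\<theta>}. (u has_real_derivative u' s) (at s within {0..\<theta>}) \<and>
                    (u' has_real_derivative - \<kappa> s * u s) (at s within {0..\<theta>})))"

definition sn :: "(real \<Rightarrow> real) \<Rightarrow> real \<Rightarrow> real \<Rightarrow> real" where
  "sn \<kappa> \<theta> = (THE u. is_sn \<kappa> \<theta> u)"

definition sigma_cont :: "real \<Rightarrow> (real \<Rightarrow> real) \<Rightarrow> real \<Rightarrow> ennreal" where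
  "sigma_cont t \<kappa> \<theta> =
     (if \<forall>s\<in>{0<..\<theta>}. 0 < sn \<kappa> \<theta> s then ennreal (sn \<kappa> \<theta> (t * \<theta>) / sn \<kappa> \<theta> \<theta>) else top)"

definition lip_approx :: "(real \<Rightarrow> real) \<Rightarrow> real \<Rightarrow> nat \<Rightarrow> real \<Rightarrow> real" where
  "lip_approx \<kappa> \<theta> n s = (INF r\<in>{0..\<theta>}. \<kappa> r + real n * \<bar>s - r\<bar>)"

definition sigma_coeff :: "real \<Rightarrow> (real \<Rightarrow> real) \<Rightarrow> real \<Rightarrow> ennreal" where
  "sigma_coeff t \<kappa> \<theta> =
     (if \<theta> = 0 then ennreal t else lim (\<lambda>n. sigma_cont t (lip_approx \<kappa> \<theta> n) \<theta>))"

text \<open>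
  For \<open>N = 1\<close>, positivity of \<open>\<kappa>\<close> means positivity at all points of \<open>[0,\<theta>]\<close>.
\<close>

definition tau_coeff :: "real \<Rightarrow> (real \<Rightarrow> real) \<Rightarrow> real \<Rightarrow> real \<Rightarrow> ennreal" where
  "tau_coeff t \<kappa> N \<theta> =
     (if N = 1 then (if \<forall>s\<in>{0..\<theta>}. 0 < \<kappa> s then ennreal \<theta> * top else ennreal t)
      else ennreal (t powr (1 / N)) *
           epow (sigma_coeff t (\<lambda>s. \<kappa> s / (N - 1)) \<theta>) ((N - 1) / N))"

text \<open>
  The function \<open>k\<close> along the unit speed reparametrization of \<open>\<gamma>\<close>. For a constant geodesic the
  division by the speed is a division by \<open>0\<close>, which gives the value of \<open>k\<close> at that point.
\<close>

definition k_plus :: "('a::metric_space \<Rightarrow> real) \<Rightarrow> (real \<Rightarrow> 'a) \<Rightarrow> real \<Rightarrow> real" where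
  "k_plus k \<gamma> s = k (\<gamma> (s / speed \<gamma>))"

definition k_minus :: "('a::metric_space \<Rightarrow> real) \<Rightarrow> (real \<Rightarrow> 'a) \<Rightarrow> real \<Rightarrow> real" where
  "k_minus k \<gamma> s = k_plus k \<gamma> (speed \<gamma> - s)"


section \<open>The curvature-dimension condition\<close>

definition lebesgue_decomposition ::
    "'a measure \<Rightarrow> 'a measure \<Rightarrow> ('a \<Rightarrow> ennreal) \<Rightarrow> 'a measure \<Rightarrow> bool" where
  "lebesgue_decomposition M \<nu> \<rho> \<nu>\<^sub>s \<longleftrightarrow>
     \<rho> \<in> borel_measurable M \<and> sets \<nu>\<^sub>s = sets M \<and>
     (\<exists>Z\<in>null_sets M. emeasure \<nu>\<^sub>s (space M - Z) = 0) \<and>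
     (\<forall>A\<in>sets M. emeasure \<nu> A = emeasure (density M \<rho>) A + emeasure \<nu>\<^sub>s A)"

text \<open>The choice of \<open>\<rho>\<close> is immaterial: it is unique almost everywhere.\<close>

definition S_ent :: "'a measure \<Rightarrow> real \<Rightarrow> 'a measure \<Rightarrow> ereal" where
  "S_ent M N \<nu> =
     (let \<rho> = (SOME \<rho>. \<exists>\<nu>\<^sub>s. lebesgue_decomposition M \<nu> \<rho> \<nu>\<^sub>s)
      in - enn2ereal (\<integral>\<^sup>+ x. epow (\<rho> x) (1 - 1 / N) \<partial>M))"

definition CD :: "'a::polish_space measure \<Rightarrow> ('a \<Rightarrow> real) \<Rightarrow> real \<Rightarrow> bool" where
  "CD M k N \<longleftrightarrow>
     (\<forall>\<rho>\<^sub>0 \<in> borel_measurable M. \<forall>\<rho>\<^sub>1 \<in> borel_measurable M.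
        density M \<rho>\<^sub>0 \<in> P2_ac M \<longrightarrow> density M \<rho>\<^sub>1 \<in> P2_ac M \<longrightarrow>
        bounded (msupp (density M \<rho>\<^sub>0)) \<longrightarrow> bounded (msupp (density M \<rho>\<^sub>1)) \<longrightarrow>
        (\<exists>\<Theta> \<nu>.
           dynamical_optimal_coupling \<Theta> (density M \<rho>\<^sub>0) (density M \<rho>\<^sub>1) \<and>
           constant_speed_geodesic W2 \<nu> \<and> (\<forall>t\<in>{0..1}. \<nu> t \<in> P2_ac M) \<and>
           \<nu> 0 = density M \<rho>\<^sub>0 \<and> \<nu> 1 = density M \<rho>\<^sub>1 \<and>
           (\<forall>t\<in>{0..1}. \<forall>N'\<ge>N.
              S_ent M N' (\<nu> t) \<le>
                - enn2ereal (\<integral>\<^sup>+ \<gamma>.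
                    (tau_coeff (1 - t) (k_minus k \<gamma>) N' (speed \<gamma>) * epow (\<rho>\<^sub>0 (\<gamma> 0)) (- 1 / N') +
                     tau_coeff t (k_plus k \<gamma>) N' (speed \<gamma>) * epow (\<rho>\<^sub>1 (\<gamma> 1)) (- 1 / N')) \<partial>\<Theta>))))"

end

theory Submission
  imports Defs
begin

text \<open>
  Let \<open>A\<^sub>t\<close> be the set of \<open>t\<close>-intermediate points. When the two sets have finite mass, the inequality is \<^const>\<open>CD\<close>
  applied to the normalised restrictions \<open>\<rho>\<^sub>i = 1 / m(A\<^sub>i)\<close> on \<open>A\<^sub>i\<close>. The dynamical coupling only charges geodesics
  from \<open>A\<^sub>0\<close> to \<open>A\<^sub>1\<close>; there \<open>\<rho>\<^sub>i powr (-1/N) = m(A\<^sub>i) powr (1/N)\<close>, and the distortion coefficients are at least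
  their infima, so the right-hand integral of \<^const>\<open>CD\<close> is at least the left-hand side of the claim. In the other
  direction, if \<open>\<nu>\<^sub>t\<close> gives full mass to a Borel set \<open>B\<close>, concavity of \<open>r powr (1-1/N)\<close> bounds the entropy of
  \<open>\<nu>\<^sub>t\<close> by \<open>m(B) powr (1/N)\<close> (\<open>entropy_lower_bound\<close>). With \<open>B\<close> a measurable hull of \<open>A\<^sub>t\<close> this is the claim.
  Infinite masses follow by exhaustion from inside, which only shrinks the set of geodesics.

  The hard point is that \<open>\<nu>\<^sub>t\<close> gives full mass to every Borel set containing \<open>A\<^sub>t\<close>
  (\<open>full_mass_of_intermediate_points\<close>). The curve \<open>\<nu>\<close> and the dynamical coupling in \<^const>\<open>CD\<close> are not tied to each
  other, so one needs that a geodesic of the Wasserstein space is carried by geodesics of the space, although the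
  space itself is only complete and separable. Instead of constructing a measure on paths, the proof works with
  finitely many times and lets compactness do the rest:

  \<^item> Space is cut into countably many small cells, so that all couplings become discrete and can be glued into a
    Markov chain (\<open>pmf_chain_gluing\<close>) that visits times \<open>0 = u\<^sub>0 < ... < u\<^sub>n = 1\<close> with near-optimal steps.
  \<^item> If \<open>h\<^sub>i\<close> are the time steps, \<open>d\<^sub>i\<close> the lengths of the steps of the chain and \<open>D\<close> the distance of its ends, then
    \<open>\<Sum> h\<^sub>i (d\<^sub>i / h\<^sub>i - D)\<^sup>2 \<le> \<Sum> d\<^sub>i\<^sup>2 / h\<^sub>i - D\<^sup>2\<close> (\<open>chain_excess\<close>). Up to small errors the first sum on the right has
    expectation at most \<open>W\<^sup>2\<close>, with \<open>W\<close> the Wasserstein distance of the ends, because \<open>\<nu>\<close> has constant speed; and \<open>D\<^sup>2\<close> has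
    expectation at least \<open>W\<^sup>2\<close>. Hence \<open>d\<^sub>i\<close> exceeds \<open>h\<^sub>i D\<close> noticeably only with small probability
    (\<open>ex_discrete_geodesic_law\<close>).
  \<^item> So the positions at time \<open>t\<close> of approximate geodesic chains that stay in a given sequence of compact sets have
    almost full \<open>\<nu>\<^sub>t\<close>-mass (\<open>projection_approx_chains_mass\<close>). These sets of chains are compact and decrease as more
    times and smaller errors are prescribed; in the limit one obtains chains over a dense set of times that
    extend to true geodesics.
\<close>

section \<open>Discretisation and gluing of couplings\<close>

text \<open>
  The cells are the fibres of \<open>q\<close>, and \<open>c n\<close> is the centre of the cell \<open>n\<close>. The centres enumerate a countable dense
  set, and a point goes to the first centre within distance \<open>\<delta>\<close>.
\<close>

lemma ex_quantizer:
  fixes \<delta> :: real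
  assumes "0 < \<delta>"
  obtains q :: "'a::polish_space \<Rightarrow> nat" and c :: "nat \<Rightarrow> 'a"
  where "q \<in> measurable borel (count_space UNIV)" "\<And>x. dist x (c (q x)) < \<delta>"
proof -
  obtain D :: "'a set" where D: "countable D" "\<And>X. open X \<Longrightarrow> X \<noteq> {} \<Longrightarrow> \<exists>d\<in>D. d \<in> X"
    using countable_dense_exists by blast
  define c where "c = from_nat_into D"
  define q where "q x = (LEAST n. dist x (c n) < \<delta>)" for x
  have ne: "D \<noteq> {}" using D(2)[of UNIV] by auto
  have ex: "\<exists>n. dist x (c n) < \<delta>" for x
  proof -
    obtain d where "d \<in> D" "d \<in> ball x \<delta>"
      using D(2)[of "ball x \<delta>"] assms by auto
    then show ?thesis
      using from_nat_into_surj[OF D(1)] unfolding c_def by (metis mem_ball)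
  qed
  have "q \<in> measurable borel (count_space UNIV)"
    unfolding q_def by measurable
  moreover have "dist x (c (q x)) < \<delta>" for x
    unfolding q_def using ex[of x] by (rule LeastI_ex)
  ultimately show thesis by (rule that)
qed

lemma ex_pmf_of_law:
  fixes f :: "'a \<Rightarrow> 'b::countable"
  assumes "prob_space \<mu>" and f: "f \<in> measurable \<mu> (count_space UNIV)"
  obtains p where "measure_pmf p = distr \<mu> (count_space UNIV) f"
proof -
  interpret prob_space \<mu> by fact
  let ?D = "distr \<mu> (count_space UNIV) f"
  interpret D: prob_space ?D using f by (rule prob_space_distr)
  have "AE x in ?D. measure ?D {x} \<noteq> 0"
    by (subst D.AE_support_countable) (auto intro!: exI[of _ UNIV])
  then have "measure_pmf (Abs_pmf ?D) = ?D"
    by (intro Abs_pmf_inverse) (auto simp: D.prob_space_axioms)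
  then show thesis by (rule that)
qed

text \<open>
  Gluing along a common marginal needs no disintegration for discrete laws: the next point is drawn from the
  conditional law of \<open>J n\<close> given its first coordinate.
\<close>

lemma pmf_chain_gluing:
  fixes J :: "nat \<Rightarrow> ('b \<times> 'b) pmf"
  assumes "\<And>i. Suc i < n \<Longrightarrow> map_pmf snd (J i) = map_pmf fst (J (Suc i))"
  shows "\<exists>P :: (nat \<Rightarrow> 'b) pmf. \<forall>i<n. map_pmf (\<lambda>f. (f i, f (Suc i))) P = J i"
  using assms
proof (induction n)
  case 0
  then show ?case by simp
next
  case (Suc n)
  then obtain P :: "(nat \<Rightarrow> 'b) pmf"
    where P: "\<And>i. i < n \<Longrightarrow> map_pmf (\<lambda>f. (f i, f (Suc i))) P = J i"
    by auto
  show ?case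
  proof (cases "n = 0")
    case True
    show ?thesis
      by (rule exI[of _ "map_pmf (\<lambda>(a, b) i. if i = 0 then a else b) (J 0)"])
        (simp add: True map_pmf_comp split_beta)
  next
    case False
    then obtain m where n: "n = Suc m" by (cases n) auto
    have last: "map_pmf (\<lambda>f. f n) P = map_pmf fst (J n)"
    proof -
      have "map_pmf (\<lambda>f. f n) P = map_pmf snd (map_pmf (\<lambda>f. (f m, f (Suc m))) P)"
        by (simp add: map_pmf_comp n)
      also have "\<dots> = map_pmf fst (J n)" using P[of m] Suc.prems[of m] by (simp add: n)
      finally show ?thesis .
    qed
    define K where "K f = cond_pmf (J n) {z. f n = fst z}" for f :: "nat \<Rightarrow> 'b"
    have cancel: "bind_pmf P K = J n"
      unfolding K_def
    proof (rule bind_cond_pmf_cancel)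
      fix f assume "f \<in> set_pmf P"
      then have "f n \<in> set_pmf (map_pmf (\<lambda>f. f n) P)" by simp
      then show "set_pmf (J n) \<inter> {z. f n = fst z} \<noteq> {}"
        unfolding last by auto
    next
      fix z assume "z \<in> set_pmf (J n)"
      then have "fst z \<in> set_pmf (map_pmf fst (J n))" by simp
      then show "set_pmf P \<inter> {f. f n = fst z} \<noteq> {}"
        unfolding last[symmetric] by auto
    next
      fix f :: "nat \<Rightarrow> 'b" and z :: "'b \<times> 'b"
      assume fz: "f n = fst z"
      have "measure (J n) {z. f n = fst z} = measure (map_pmf fst (J n)) {f n}"
        by (simp add: vimage_def eq_commute)
      also have "\<dots> = measure P {f. f n = fst z}"
        unfolding last[symmetric] by (simp add: vimage_def fz)
      finally show "measure (J n) {z. f n = fst z} = measure P {f. f n = fst z}" .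
    qed
    have K_set: "fst z = f n" if "f \<in> set_pmf P" "z \<in> set_pmf (K f)" for f z
    proof -
      have "f n \<in> set_pmf (map_pmf (\<lambda>f. f n) P)" using that by simp
      then have "set_pmf (J n) \<inter> {z. f n = fst z} \<noteq> {}"
        unfolding last by auto
      then show ?thesis using that(2) by (auto simp: K_def)
    qed
    define Q where "Q = bind_pmf P (\<lambda>f. map_pmf (\<lambda>z. f(Suc n := snd z)) (K f))"
    have old: "map_pmf (\<lambda>f. (f i, f (Suc i))) Q = J i" if "i < n" for i
      using P[OF that] that
      by (simp add: Q_def map_bind_pmf map_pmf_comp map_pmf_const map_pmf_def[symmetric])
    have "map_pmf (\<lambda>f. (f n, f (Suc n))) Q = bind_pmf P (\<lambda>f. map_pmf (\<lambda>z. (f n, snd z)) (K f))"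
      by (simp add: Q_def map_bind_pmf map_pmf_comp)
    also have "\<dots> = bind_pmf P (\<lambda>f. map_pmf (\<lambda>z. z) (K f))"
      by (intro bind_pmf_cong refl map_pmf_cong) (auto simp: prod_eq_iff K_set)
    also have "\<dots> = J n" using cancel by simp
    finally show ?thesis
      using old by (intro exI[of _ Q]) (auto simp: less_Suc_eq)
  qed
qed

text \<open>
  The integrand is the density of a joint law with respect to the product of its marginals. For a fixed first
  coordinate it integrates to 1, which is what makes both marginals correct in the lemma below.
\<close>

lemma nn_integral_conditional_pmf:
  fixes P :: "('b \<times> 'c) pmf"
  assumes "i \<in> set_pmf (map_pmf fst P)"
  shows "(\<integral>\<^sup>+ j. ennreal (pmf P (i, j) / (pmf (map_pmf fst P) i * pmf (map_pmf snd P) j))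
            \<partial>measure_pmf (map_pmf snd P)) = 1"
proof -
  let ?a = "pmf (map_pmf fst P) i" and ?b = "pmf (map_pmf snd P)"
  have a: "0 < ?a" using assms by (simp add: pmf_positive_iff)
  have b: "?b j * (pmf P (i, j) / (?a * ?b j)) = pmf P (i, j) / ?a" for j
  proof (cases "?b j = 0")
    case True
    then have "(i, j) \<notin> set_pmf P" by (force simp: pmf_eq_0_set_pmf)
    then show ?thesis by (simp add: True pmf_eq_0_set_pmf)
  qed simp
  have "(\<integral>\<^sup>+ j. ennreal (pmf P (i, j) / (?a * ?b j)) \<partial>measure_pmf (map_pmf snd P)) =
        (\<integral>\<^sup>+ j. ennreal (?b j) * ennreal (pmf P (i, j) / (?a * ?b j)) \<partial>count_space UNIV)"
    by (rule nn_integral_measure_pmf)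
  also have "\<dots> = (\<integral>\<^sup>+ j. ennreal (pmf P (i, j)) / ennreal ?a \<partial>count_space UNIV)"
    using a by (simp only: ennreal_mult'[symmetric] pmf_nonneg b) (simp add: divide_ennreal)
  also have "\<dots> = (\<integral>\<^sup>+ j. ennreal (pmf P (i, j)) \<partial>count_space UNIV) / ennreal ?a"
    by (simp add: nn_integral_divide)
  also have "(\<integral>\<^sup>+ j. ennreal (pmf P (i, j)) \<partial>count_space UNIV) =
             (\<integral>\<^sup>+ z. ennreal (pmf P z) \<partial>count_space ((\<lambda>j. (i, j)) ` UNIV))"
    by (subst nn_integral_bij_count_space[of "\<lambda>j. (i, j)" UNIV, symmetric])
      (auto simp: bij_betw_def inj_on_def)
  also have "\<dots> = emeasure (measure_pmf P) ((\<lambda>j. (i, j)) ` UNIV)"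
    by (rule nn_integral_pmf)
  also have "(\<lambda>j. (i, j)) ` UNIV = fst -` {i}" by auto
  also have "emeasure (measure_pmf P) (fst -` {i}) = ennreal ?a"
    by (simp add: measure_pmf.emeasure_eq_measure pmf_map)
  finally show ?thesis using a by (simp add: ennreal_divide_self)
qed

text \<open>
  A coupling of the laws of the cells comes from a coupling of the measures: take the product measure with the
  density that depends on the cells only. Thus a lower bound on the transport cost, such as the Wasserstein
  distance, also bounds the cost of discrete couplings from below.
\<close>

lemma lift_discrete_coupling:
  fixes \<mu> \<nu> :: "'a::polish_space measure" and q :: "'a \<Rightarrow> 'b::countable" and P :: "('b \<times> 'b) pmf"
  assumes \<mu>: "prob_space \<mu>" "sets \<mu> = sets borel" and \<nu>: "prob_space \<nu>" "sets \<nu> = sets borel"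
    and q: "q \<in> measurable borel (count_space UNIV)"
    and P1: "measure_pmf (map_pmf fst P) = distr \<mu> (count_space UNIV) q"
    and P2: "measure_pmf (map_pmf snd P) = distr \<nu> (count_space UNIV) q"
  obtains \<pi> where "\<pi> \<in> couplings \<mu> \<nu>"
    "\<And>g. (\<integral>\<^sup>+ z. g (q (fst z), q (snd z)) \<partial>\<pi>) = (\<integral>\<^sup>+ w. g w \<partial>measure_pmf P)"
proof -
  interpret M: prob_space \<mu> by fact
  interpret N: prob_space \<nu> by fact
  interpret MN: pair_sigma_finite \<mu> \<nu> ..
  let ?a = "pmf (map_pmf fst P)" and ?b = "pmf (map_pmf snd P)"
  define r where "r i j = pmf P (i, j) / (?a i * ?b j)" for i j
  define F where "F z = ennreal (r (q (fst z)) (q (snd z)))" for z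
  have [measurable_cong]: "sets \<mu> = sets borel" "sets \<nu> = sets borel" by fact+
  note [measurable] = q
  have qM: "q \<in> measurable \<mu> (count_space UNIV)" and qN: "q \<in> measurable \<nu> (count_space UNIV)"
    by measurable
  have pair_q: "(\<lambda>z. g (q (fst z)) (q (snd z))) \<in> borel_measurable (\<mu> \<Otimes>\<^sub>M \<nu>)"
    for g :: "'b \<Rightarrow> 'b \<Rightarrow> ennreal"
    by measurable
  have F_meas: "F \<in> borel_measurable (\<mu> \<Otimes>\<^sub>M \<nu>)"
    unfolding F_def by (rule pair_q)
  define \<pi> where "\<pi> = density (\<mu> \<Otimes>\<^sub>M \<nu>) F"
  have sets_pair: "sets (\<mu> \<Otimes>\<^sub>M \<nu>) = sets (borel :: ('a \<times> 'a) measure)"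
    by (metis \<mu>(2) \<nu>(2) borel_prod sets_pair_measure_cong)
  have sp: "space \<mu> = UNIV" "space \<nu> = UNIV"
    using \<mu>(2) \<nu>(2) by (auto dest: sets_eq_imp_space_eq)
  have int_nu: "(\<integral>\<^sup>+ y. h (q y) \<partial>\<nu>) = (\<integral>\<^sup>+ j. h j \<partial>measure_pmf (map_pmf snd P))" for h :: "'b \<Rightarrow> ennreal"
    unfolding P2 by (subst nn_integral_distr[OF qN]) simp_all
  have int_mu: "(\<integral>\<^sup>+ y. h (q y) \<partial>\<mu>) = (\<integral>\<^sup>+ j. h j \<partial>measure_pmf (map_pmf fst P))" for h :: "'b \<Rightarrow> ennreal"
    unfolding P1 by (subst nn_integral_distr[OF qM]) simp_all
  have AE_mu: "AE x in \<mu>. q x \<in> set_pmf (map_pmf fst P)"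
  proof -
    have "AE i in distr \<mu> (count_space UNIV) q. i \<in> set_pmf (map_pmf fst P)"
      unfolding P1[symmetric] by (rule AE_measure_pmf)
    then show ?thesis by (subst (asm) AE_distr_iff[OF qM]) simp_all
  qed
  have AE_nu: "AE x in \<nu>. q x \<in> set_pmf (map_pmf snd P)"
  proof -
    have "AE i in distr \<nu> (count_space UNIV) q. i \<in> set_pmf (map_pmf snd P)"
      unfolding P2[symmetric] by (rule AE_measure_pmf)
    then show ?thesis by (subst (asm) AE_distr_iff[OF qN]) simp_all
  qed
  have inner1: "AE x in \<mu>. (\<integral>\<^sup>+ y. F (x, y) \<partial>\<nu>) = 1"
    using AE_mu
  proof eventually_elim
    case (elim x)
    show ?case
      unfolding F_def using nn_integral_conditional_pmf[OF elim]
      by (simp add: int_nu[of "\<lambda>j. ennreal (r (q x) j)", unfolded r_def] r_def del: nn_integral_map_pmf)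
  qed
  have inner2: "AE y in \<nu>. (\<integral>\<^sup>+ x. F (x, y) \<partial>\<mu>) = 1"
    using AE_nu
  proof eventually_elim
    case (elim y)
    have eq: "pmf (map_pmf prod.swap P) (j, i) = pmf P (i, j)" for i j
    proof -
      have "pmf (map_pmf prod.swap P) (prod.swap (i, j)) = pmf P (i, j)"
        by (rule pmf_map_inj') simp
      then show ?thesis by simp
    qed
    have m: "map_pmf fst (map_pmf prod.swap P) = map_pmf snd P"
        "map_pmf snd (map_pmf prod.swap P) = map_pmf fst P"
      by (simp_all add: map_pmf_comp)
    show ?case
      unfolding F_def
      using nn_integral_conditional_pmf[of "q y" "map_pmf prod.swap P"] elim
      by (simp add: int_mu[of "\<lambda>i. ennreal (r i (q y))", unfolded r_def] r_def m eq mult.commute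
          del: set_map_pmf nn_integral_map_pmf)
  qed
  have marg1: "distr \<pi> borel fst = \<mu>"
  proof (rule measure_eqI)
    fix A assume "A \<in> sets (distr \<pi> borel fst)"
    then have [measurable]: "A \<in> sets borel" by simp
    have vim: "fst -` A \<in> sets (\<mu> \<Otimes>\<^sub>M \<nu>)"
      using measurable_sets[of fst "\<mu> \<Otimes>\<^sub>M \<nu>" \<mu> A] by (simp add: space_pair_measure sp)
    have "emeasure (distr \<pi> borel fst) A = emeasure \<pi> (fst -` A \<inter> space \<pi>)"
      by (rule emeasure_distr) (simp_all add: \<pi>_def)
    also have "\<dots> = (\<integral>\<^sup>+ z. F z * indicator A (fst z) \<partial>(\<mu> \<Otimes>\<^sub>M \<nu>))"
      unfolding \<pi>_def using F_meas vim
      by (subst emeasure_density) (auto intro!: nn_integral_cong simp: indicator_def space_pair_measure sp)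
    also have "\<dots> = (\<integral>\<^sup>+ x. \<integral>\<^sup>+ y. F (x, y) * indicator A x \<partial>\<nu> \<partial>\<mu>)"
      using F_meas by (subst N.nn_integral_fst[symmetric]) simp_all
    also have "\<dots> = (\<integral>\<^sup>+ x. indicator A x \<partial>\<mu>)"
      using inner1 F_meas by (intro nn_integral_cong_AE) (auto simp: nn_integral_multc)
    finally show "emeasure (distr \<pi> borel fst) A = emeasure \<mu> A" by simp
  qed (simp add: \<mu>)
  have marg2: "distr \<pi> borel snd = \<nu>"
  proof (rule measure_eqI)
    fix A assume "A \<in> sets (distr \<pi> borel snd)"
    then have [measurable]: "A \<in> sets borel" by simp
    have vim: "snd -` A \<in> sets (\<mu> \<Otimes>\<^sub>M \<nu>)"
      using measurable_sets[of snd "\<mu> \<Otimes>\<^sub>M \<nu>" \<nu> A] by (simp add: space_pair_measure sp)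
    have "emeasure (distr \<pi> borel snd) A = emeasure \<pi> (snd -` A \<inter> space \<pi>)"
      by (rule emeasure_distr) (simp_all add: \<pi>_def)
    also have "\<dots> = (\<integral>\<^sup>+ z. F z * indicator A (snd z) \<partial>(\<mu> \<Otimes>\<^sub>M \<nu>))"
      unfolding \<pi>_def using F_meas vim
      by (subst emeasure_density) (auto intro!: nn_integral_cong simp: indicator_def space_pair_measure sp)
    also have "\<dots> = (\<integral>\<^sup>+ y. \<integral>\<^sup>+ x. F (x, y) * indicator A y \<partial>\<mu> \<partial>\<nu>)"
      using F_meas by (subst MN.nn_integral_snd[symmetric]) simp_all
    also have "\<dots> = (\<integral>\<^sup>+ y. indicator A y \<partial>\<nu>)"
      using inner2 F_meas by (intro nn_integral_cong_AE) (auto simp: nn_integral_multc)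
    finally show "emeasure (distr \<pi> borel snd) A = emeasure \<nu> A" by simp
  qed (simp add: \<nu>)
  have joint: "(\<integral>\<^sup>+ z. g (q (fst z), q (snd z)) \<partial>\<pi>) = (\<integral>\<^sup>+ w. g w \<partial>measure_pmf P)" for g
  proof -
    have ab: "?a i * (?b j * r i j) = pmf P (i, j)" for i j
    proof (cases "?a i = 0 \<or> ?b j = 0")
      case True
      then have "(i, j) \<notin> set_pmf P" by (force simp: pmf_eq_0_set_pmf)
      then have "pmf P (i, j) = 0" by (simp add: pmf_eq_0_set_pmf)
      then show ?thesis using True by auto
    qed (simp add: r_def)
    have "(\<integral>\<^sup>+ z. g (q (fst z), q (snd z)) \<partial>\<pi>) =
          (\<integral>\<^sup>+ z. F z * g (q (fst z), q (snd z)) \<partial>(\<mu> \<Otimes>\<^sub>M \<nu>))"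
      unfolding \<pi>_def using F_meas pair_q[of "\<lambda>i j. g (i, j)"]
      by (subst nn_integral_density) simp_all
    also have "\<dots> = (\<integral>\<^sup>+ x. \<integral>\<^sup>+ y. F (x, y) * g (q x, q y) \<partial>\<nu> \<partial>\<mu>)"
      using F_meas pair_q[of "\<lambda>i j. g (i, j)"]
      by (subst N.nn_integral_fst[symmetric]) (simp_all)
    also have "\<dots> = (\<integral>\<^sup>+ x. \<integral>\<^sup>+ j. ennreal (r (q x) j) * g (q x, j) \<partial>measure_pmf (map_pmf snd P) \<partial>\<mu>)"
      unfolding F_def by (subst int_nu[symmetric]) simp
    also have "\<dots> = (\<integral>\<^sup>+ i. \<integral>\<^sup>+ j. ennreal (r i j) * g (i, j)
                   \<partial>measure_pmf (map_pmf snd P) \<partial>measure_pmf (map_pmf fst P))"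
      by (rule int_mu)
    also have "\<dots> = (\<integral>\<^sup>+ i. \<integral>\<^sup>+ j. ennreal (?a i) * (ennreal (?b j) * (ennreal (r i j) * g (i, j)))
                   \<partial>count_space UNIV \<partial>count_space UNIV)"
      unfolding nn_integral_measure_pmf by (simp add: nn_integral_cmult)
    also have "\<dots> = (\<integral>\<^sup>+ i. \<integral>\<^sup>+ j. ennreal (pmf P (i, j)) * g (i, j)
                   \<partial>count_space UNIV \<partial>count_space UNIV)"
      by (simp add: ab[symmetric] ennreal_mult' mult.assoc)
    also have "\<dots> = (\<integral>\<^sup>+ w. ennreal (pmf P w) * g w \<partial>count_space UNIV)"
      by (rule nn_integral_fst_count_space)
    also have "\<dots> = (\<integral>\<^sup>+ w. g w \<partial>measure_pmf P)"
      by (rule nn_integral_measure_pmf[symmetric])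
    finally show ?thesis .
  qed
  have "\<pi> \<in> couplings \<mu> \<nu>"
    by (simp add: couplings_def marg1 marg2) (simp add: \<pi>_def sets_pair)
  then show thesis using joint by (rule that)
qed

section \<open>Couplings and the Wasserstein distance\<close>

lemma P2_D:
  assumes "\<mu> \<in> P2"
  shows "prob_space \<mu>" "sets \<mu> = sets borel"
  using assms by (simp_all add: P2_def)

lemma couplings_measurable_projections:
  fixes \<mu> :: "'a::polish_space measure"
  assumes "\<pi> \<in> couplings \<mu> \<nu>"
  shows "fst \<in> measurable \<pi> (borel :: 'a measure)" "snd \<in> measurable \<pi> (borel :: 'a measure)"
proof -
  have s: "sets \<pi> = sets (borel \<Otimes>\<^sub>M borel :: ('a \<times> 'a) measure)"
    using assms by (subst borel_prod) (simp add: couplings_def)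
  show "fst \<in> measurable \<pi> (borel :: 'a measure)" "snd \<in> measurable \<pi> (borel :: 'a measure)"
    unfolding measurable_cong_sets[OF s refl] by simp_all
qed

lemma couplings_prob_space:
  fixes \<mu> :: "'a::polish_space measure"
  assumes "\<pi> \<in> couplings \<mu> \<nu>" "prob_space \<mu>"
  shows "prob_space \<pi>"
proof -
  have "distr \<pi> borel fst = \<mu>" and s: "sets \<pi> = sets borel" using assms by (auto simp: couplings_def)
  then have "emeasure (distr \<pi> borel fst) (space (distr \<pi> borel fst)) = 1"
    using assms(2) by (simp add: prob_space.emeasure_space_1)
  moreover note couplings_measurable_projections[OF assms(1)]
  ultimately show ?thesis
    by (intro prob_spaceI) (simp add: emeasure_distr)
qed

text \<open>
  Existence of one coupling of finite cost is needed because \<^const>\<open>W2\<close> reads an infinite infimum as \<open>0\<close>.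
\<close>

lemma product_coupling:
  fixes \<mu> \<nu> :: "'a::polish_space measure"
  assumes \<mu>: "prob_space \<mu>" "sets \<mu> = sets borel" and \<nu>: "prob_space \<nu>" "sets \<nu> = sets borel"
  shows "\<mu> \<Otimes>\<^sub>M \<nu> \<in> couplings \<mu> \<nu>"
proof -
  interpret M: prob_space \<mu> by fact
  interpret N: prob_space \<nu> by fact
  interpret MN: pair_prob_space \<mu> \<nu> ..
  have "sets (\<mu> \<Otimes>\<^sub>M \<nu>) = sets (borel :: ('a \<times> 'a) measure)"
    by (metis \<mu>(2) \<nu>(2) borel_prod sets_pair_measure_cong)
  moreover have "distr (\<mu> \<Otimes>\<^sub>M \<nu>) borel fst = \<mu>"
    using N.distr_pair_fst[of \<mu>] \<mu>(2) by (metis distr_cong)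
  moreover have "distr (\<mu> \<Otimes>\<^sub>M \<nu>) borel snd = \<nu>"
  proof (rule measure_eqI)
    fix A assume A: "A \<in> sets (distr (\<mu> \<Otimes>\<^sub>M \<nu>) borel snd)"
    then have A': "A \<in> sets \<nu>" using \<nu> by simp
    have sp: "space \<mu> = UNIV" "space \<nu> = UNIV"
      using \<mu>(2) \<nu>(2) by (auto dest: sets_eq_imp_space_eq)
    have "snd \<in> measurable (\<mu> \<Otimes>\<^sub>M \<nu>) borel"
      using measurable_snd[of \<mu> \<nu>] \<nu>(2) by (metis measurable_cong_sets)
    then have "emeasure (distr (\<mu> \<Otimes>\<^sub>M \<nu>) borel snd) A = emeasure (\<mu> \<Otimes>\<^sub>M \<nu>) (UNIV \<times> A)"
      using A by (subst emeasure_distr) (auto simp: space_pair_measure sp intro!: arg_cong[of _ _ "emeasure _"])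
    also have "\<dots> = emeasure \<mu> UNIV * emeasure \<nu> A"
      using A' sp sets.top[of \<mu>] by (intro N.emeasure_pair_measure_Times) auto
    finally show "emeasure (distr (\<mu> \<Otimes>\<^sub>M \<nu>) borel snd) A = emeasure \<nu> A"
      using M.emeasure_space_1 sp by simp
  qed (simp add: \<nu>)
  ultimately show ?thesis by (simp add: couplings_def)
qed

lemma dist_square_le: "(dist x z)\<^sup>2 \<le> 2 * (dist y x)\<^sup>2 + 2 * (dist y z)\<^sup>2"
proof -
  have "dist x z \<le> dist y x + dist y z" by (metis dist_commute dist_triangle)
  then have "(dist x z)\<^sup>2 \<le> (dist y x + dist y z)\<^sup>2" by (intro power_mono) auto
  also have "\<dots> \<le> 2 * (dist y x)\<^sup>2 + 2 * (dist y z)\<^sup>2"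
    using sum_squares_ge_zero[of "dist y x - dist y z" 0] by (simp add: power2_eq_square algebra_simps)
  finally show ?thesis .
qed

lemma P2_second_moment:
  fixes \<mu> :: "'a::polish_space measure"
  assumes "\<mu> \<in> P2"
  shows "(\<integral>\<^sup>+ x. ennreal ((dist a x)\<^sup>2) \<partial>\<mu>) < top"
proof -
  obtain x0 where x0: "(\<integral>\<^sup>+ x. ennreal ((dist x0 x)\<^sup>2) \<partial>\<mu>) < top"
    using assms by (auto simp: P2_def)
  interpret prob_space \<mu> using P2_D[OF assms] by simp
  have [measurable_cong]: "sets \<mu> = sets borel" using P2_D[OF assms] by simp
  have "(\<integral>\<^sup>+ x. ennreal ((dist a x)\<^sup>2) \<partial>\<mu>) \<le>
        (\<integral>\<^sup>+ x. ennreal (2 * (dist x0 a)\<^sup>2) + 2 * ennreal ((dist x0 x)\<^sup>2) \<partial>\<mu>)"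
    using dist_square_le[of a _ x0]
    by (intro nn_integral_mono) (simp add: ennreal_plus[symmetric] ennreal_mult'[symmetric]
        ennreal_numeral[symmetric] del: ennreal_plus ennreal_numeral)
  also have "\<dots> = ennreal (2 * (dist x0 a)\<^sup>2) + 2 * (\<integral>\<^sup>+ x. ennreal ((dist x0 x)\<^sup>2) \<partial>\<mu>)"
    by (simp add: nn_integral_add nn_integral_cmult emeasure_space_1)
  also have "\<dots> < top" using x0 by (auto simp: ennreal_mult_less_top)
  finally show ?thesis .
qed

lemma transport_cost_finite:
  fixes \<mu> \<nu> :: "'a::polish_space measure"
  assumes \<mu>: "\<mu> \<in> P2" and \<nu>: "\<nu> \<in> P2" and \<pi>: "\<pi> \<in> couplings \<mu> \<nu>"
  shows "transport_cost \<pi> < top"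
proof -
  define a :: 'a where "a = undefined"
  have [measurable_cong]: "sets \<pi> = sets borel"
    and d: "distr \<pi> borel fst = \<mu>" "distr \<pi> borel snd = \<nu>"
    using \<pi> by (auto simp: couplings_def)
  note [measurable] = couplings_measurable_projections[OF \<pi>]
  have "transport_cost \<pi> \<le> (\<integral>\<^sup>+ p. 2 * ennreal ((dist a (fst p))\<^sup>2) + 2 * ennreal ((dist a (snd p))\<^sup>2) \<partial>\<pi>)"
    unfolding transport_cost_def using dist_square_le[of _ _ a]
    by (intro nn_integral_mono) (simp add: ennreal_plus[symmetric] ennreal_mult'[symmetric]
        ennreal_numeral[symmetric] del: ennreal_plus ennreal_numeral)
  also have "\<dots> = 2 * (\<integral>\<^sup>+ x. ennreal ((dist a x)\<^sup>2) \<partial>\<mu>) + 2 * (\<integral>\<^sup>+ x. ennreal ((dist a x)\<^sup>2) \<partial>\<nu>)"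
    unfolding d[symmetric] by (simp add: nn_integral_distr nn_integral_add nn_integral_cmult)
  also have "\<dots> < top"
    using P2_second_moment[OF \<mu>] P2_second_moment[OF \<nu>] by (auto simp: ennreal_mult_less_top)
  finally show ?thesis .
qed

lemma W2_square:
  fixes \<mu> \<nu> :: "'a::polish_space measure"
  assumes \<mu>: "\<mu> \<in> P2" and \<nu>: "\<nu> \<in> P2"
  shows "ennreal ((W2 \<mu> \<nu>)\<^sup>2) = (INF \<pi>\<in>couplings \<mu> \<nu>. transport_cost \<pi>)"
proof -
  have c: "\<mu> \<Otimes>\<^sub>M \<nu> \<in> couplings \<mu> \<nu>" using P2_D[OF \<mu>] P2_D[OF \<nu>] by (intro product_coupling)
  have "(INF \<pi>\<in>couplings \<mu> \<nu>. transport_cost \<pi>) \<le> transport_cost (\<mu> \<Otimes>\<^sub>M \<nu>)"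
    using c by (rule INF_lower)
  also have "\<dots> < top" using transport_cost_finite[OF \<mu> \<nu> c] .
  finally show ?thesis by (simp add: W2_def)
qed

lemma W2_square_le_cost:
  fixes \<mu> \<nu> :: "'a::polish_space measure"
  assumes "\<mu> \<in> P2" "\<nu> \<in> P2" "\<pi> \<in> couplings \<mu> \<nu>"
  shows "ennreal ((W2 \<mu> \<nu>)\<^sup>2) \<le> transport_cost \<pi>"
  unfolding W2_square[OF assms(1,2)] using assms(3) by (rule INF_lower)

lemma ex_near_optimal_coupling:
  fixes \<mu> \<nu> :: "'a::polish_space measure"
  assumes "\<mu> \<in> P2" "\<nu> \<in> P2" "0 < \<delta>"
  obtains \<pi> where "\<pi> \<in> couplings \<mu> \<nu>" "transport_cost \<pi> \<le> ennreal ((W2 \<mu> \<nu>)\<^sup>2 + \<delta>)"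
proof -
  have "(INF \<pi>\<in>couplings \<mu> \<nu>. transport_cost \<pi>) < ennreal ((W2 \<mu> \<nu>)\<^sup>2 + \<delta>)"
    unfolding W2_square[OF assms(1,2), symmetric] using assms(3) by (intro ennreal_lessI) (auto intro: add_nonneg_pos)
  then obtain \<pi> where "\<pi> \<in> couplings \<mu> \<nu>" "transport_cost \<pi> < ennreal ((W2 \<mu> \<nu>)\<^sup>2 + \<delta>)"
    by (auto simp: INF_less_iff)
  then show thesis by (intro that) auto
qed

text \<open>
  The cross term is absorbed by \<open>4 a \<delta> \<le> \<delta> a\<^sup>2 + 4 \<delta>\<close>.
\<close>

lemma power2_add_le:
  fixes a \<delta> :: real
  assumes "0 \<le> \<delta>" "\<delta> \<le> 1"
  shows "(a + 2 * \<delta>)\<^sup>2 \<le> (1 + \<delta>) * a\<^sup>2 + 8 * \<delta>"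
proof -
  have "(1 + \<delta>) * a\<^sup>2 + 8 * \<delta> - (a + 2 * \<delta>)\<^sup>2 = \<delta> * (a - 2)\<^sup>2 + 4 * \<delta> * (1 - \<delta>)"
    by (simp add: power2_eq_square algebra_simps)
  also have "\<dots> \<ge> 0" using assms by simp
  finally show ?thesis by simp
qed

text \<open>
  Replacing both end points by the centres of their cells changes distances by at most \<open>2 \<delta>\<close>; this is the effect on
  the transport cost. It is used for passing to centres and for returning from them.
\<close>

lemma nn_integral_square_perturb:
  fixes f g :: "'b \<Rightarrow> real"
  assumes "prob_space M" and g: "g \<in> borel_measurable M" and \<delta>: "0 \<le> \<delta>" "\<delta> \<le> 1"
    and fg: "\<And>x. 0 \<le> f x" "\<And>x. f x \<le> g x + 2 * \<delta>"
  shows "(\<integral>\<^sup>+ x. ennreal ((f x)\<^sup>2) \<partial>M) \<le> ennreal (1 + \<delta>) * (\<integral>\<^sup>+ x. ennreal ((g x)\<^sup>2) \<partial>M) + ennreal (8 * \<delta>)"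
proof -
  interpret prob_space M by fact
  have "(f x)\<^sup>2 \<le> (1 + \<delta>) * (g x)\<^sup>2 + 8 * \<delta>" for x
  proof -
    have "(f x)\<^sup>2 \<le> (g x + 2 * \<delta>)\<^sup>2" using fg[of x] by (intro power_mono) auto
    also have "\<dots> \<le> (1 + \<delta>) * (g x)\<^sup>2 + 8 * \<delta>" by (rule power2_add_le[OF \<delta>])
    finally show ?thesis .
  qed
  then have "(\<integral>\<^sup>+ x. ennreal ((f x)\<^sup>2) \<partial>M) \<le>
      (\<integral>\<^sup>+ x. ennreal (1 + \<delta>) * ennreal ((g x)\<^sup>2) + ennreal (8 * \<delta>) \<partial>M)"
    using \<delta> by (intro nn_integral_mono) (simp add: ennreal_plus[symmetric] ennreal_mult'[symmetric]
         del: ennreal_plus)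
  also have "\<dots> = ennreal (1 + \<delta>) * (\<integral>\<^sup>+ x. ennreal ((g x)\<^sup>2) \<partial>M) + ennreal (8 * \<delta>)"
    using g \<delta> by (simp add: nn_integral_add nn_integral_cmult emeasure_space_1)
  finally show ?thesis .
qed

section \<open>Discrete chains along a Wasserstein geodesic\<close>

text \<open>
  The quantitative equality case of \<open>D\<^sup>2 \<le> (\<Sum> d\<^sub>i)\<^sup>2 \<le> \<Sum> d\<^sub>i\<^sup>2 / h\<^sub>i\<close>: a chain with little excess has steps
  proportional to the time steps. Expanding the square gives \<open>\<Sum> d\<^sub>i\<^sup>2 / h\<^sub>i - 2 D \<Sum> d\<^sub>i + D\<^sup>2\<close>.
\<close>

lemma chain_excess:
  fixes h d :: "nat \<Rightarrow> real"
  assumes h: "\<And>i. i < n \<Longrightarrow> 0 < h i" "(\<Sum>i<n. h i) = 1" and D: "0 \<le> D" "D \<le> (\<Sum>i<n. d i)"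
  shows "(\<Sum>i<n. h i * (d i / h i - D)\<^sup>2) \<le> (\<Sum>i<n. (d i)\<^sup>2 / h i) - D\<^sup>2"
proof -
  have "(\<Sum>i<n. h i * (d i / h i - D)\<^sup>2) = (\<Sum>i<n. (d i)\<^sup>2 / h i - 2 * D * d i + D\<^sup>2 * h i)"
  proof (intro sum.cong refl)
    fix i assume "i \<in> {..<n}"
    then have h0: "h i \<noteq> 0" using h(1)[of i] by simp
    define e where "e = d i / h i"
    have e: "d i = e * h i" using h0 by (simp add: e_def)
    have "h i * (e - D)\<^sup>2 = (e * h i) * e - 2 * D * (e * h i) + D\<^sup>2 * h i"
      by (simp add: power2_eq_square algebra_simps)
    moreover have "(d i)\<^sup>2 / h i = (e * h i) * e" using h0 by (simp add: e power2_eq_square)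
    ultimately show "h i * (d i / h i - D)\<^sup>2 = (d i)\<^sup>2 / h i - 2 * D * d i + D\<^sup>2 * h i"
      by (simp add: e_def[symmetric] e[symmetric])
  qed
  also have "\<dots> = (\<Sum>i<n. (d i)\<^sup>2 / h i) - 2 * D * (\<Sum>i<n. d i) + D\<^sup>2 * (\<Sum>i<n. h i)"
    by (simp add: sum.distrib sum_subtractf sum_distrib_left)
  also have "\<dots> \<le> (\<Sum>i<n. (d i)\<^sup>2 / h i) - 2 * D * D + D\<^sup>2"
    using mult_left_mono[OF D(2), of "2 * D"] D(1) h(2) by simp
  finally show ?thesis by (simp add: power2_eq_square)
qed

lemma dist_chain_le:
  fixes x :: "nat \<Rightarrow> 'a::metric_space"
  assumes "m \<le> n"
  shows "dist (x m) (x n) \<le> (\<Sum>i=m..<n. dist (x i) (x (Suc i)))"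
  using assms
proof (induction n rule: dec_induct)
  case (step n)
  have "dist (x m) (x (Suc n)) \<le> dist (x m) (x n) + dist (x n) (x (Suc n))" by (rule dist_triangle)
  with step show ?case by simp
qed simp

text \<open>
  Near-optimal couplings of successive measures are discretised and glued. Since \<open>\<nu>\<close> has constant speed, the
  expected excess of the resulting chain is of order \<open>\<delta>\<close>, with a constant that depends on the time grid only
  through \<open>H = \<Sum> 1 / h\<^sub>i\<close>; Markov's inequality finishes the proof.
\<close>

lemma ex_discrete_geodesic_law:
  fixes \<nu> :: "real \<Rightarrow> 'a::polish_space measure" and u :: "nat \<Rightarrow> real"
  assumes geo: "constant_speed_geodesic W2 \<nu>" and P2: "\<And>t. t \<in> {0..1} \<Longrightarrow> \<nu> t \<in> P2"
    and u: "\<And>i. i < n \<Longrightarrow> u i < u (Suc i)" "u 0 = 0" "u n = 1"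
    and pos: "0 < \<eta>" "0 < \<delta>\<^sub>0"
  obtains \<delta> :: real and q :: "'a \<Rightarrow> nat" and c :: "nat \<Rightarrow> 'a" and P :: "(nat \<Rightarrow> nat) pmf"
  where "0 < \<delta>" "\<delta> \<le> \<delta>\<^sub>0" "q \<in> measurable borel (count_space UNIV)" "\<And>x. dist x (c (q x)) < \<delta>"
    "\<And>i. i \<le> n \<Longrightarrow> measure_pmf (map_pmf (\<lambda>f. f i) P) = distr (\<nu> (u i)) (count_space UNIV) q"
    "measure P {f. \<exists>i<n. dist (c (f i)) (c (f (Suc i))) >
        (u (Suc i) - u i) * dist (c (f 0)) (c (f n)) + \<eta>} \<le> \<eta>"
proof -
  define w where "w = (W2 (\<nu> 0) (\<nu> 1))\<^sup>2"
  define h where "h i = u (Suc i) - u i" for i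
  define H where "H = (\<Sum>i<n. 1 / h i)"
  define C where "C = w + 8 + 2 * (H * (w + 10))"
  \<comment> \<open>The expected excess is at most \<open>\<delta> C\<close>, and a bad chain has excess at least \<open>\<eta>\<^sup>2\<close>. So \<open>\<delta> C \<le> \<eta> ^ 3\<close> makes
    bad chains have probability at most \<open>\<eta>\<close>.\<close>
  define \<delta> where "\<delta> = min 1 (min \<delta>\<^sub>0 (\<eta> ^ 3 / C))"
  have w: "0 \<le> w" by (simp add: w_def)
  have h_pos: "0 < h i" if "i < n" for i using u(1)[OF that] by (simp add: h_def)
  have h_sum: "(\<Sum>i<n. h i) = 1"
    unfolding h_def using sum_lessThan_telescope[of u n] u by simp
  have H: "0 \<le> H" unfolding H_def using h_pos by (intro sum_nonneg) (simp add: less_imp_le)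
  have C: "0 < C" unfolding C_def using w H by (simp add: add_nonneg_pos add_pos_nonneg)
  have \<delta>: "0 < \<delta>" "\<delta> \<le> 1" "\<delta> \<le> \<delta>\<^sub>0"
    unfolding \<delta>_def using pos C by simp_all
  have "\<delta> \<le> \<eta> ^ 3 / C" unfolding \<delta>_def by simp
  then have \<delta>C: "\<delta> * C \<le> \<eta> ^ 3" using C by (simp add: le_divide_eq)
  have u_mono: "u i \<le> u j" if "i \<le> j" "j \<le> n" for i j
    using that
  proof (induction j rule: dec_induct)
    case (step j)
    then show ?case using u(1)[of j] by simp
  qed simp
  have u01: "u i \<in> {0..1}" if "i \<le> n" for i
    using u_mono[of 0 i] u_mono[of i n] u(2,3) that by simp
  have h1: "h i \<le> 1" if "i < n" for i
    using u01[of i] u01[of "Suc i"] that by (simp add: h_def)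
  have W2_step: "(W2 (\<nu> (u i)) (\<nu> (u (Suc i))))\<^sup>2 = (h i)\<^sup>2 * w" if "i < n" for i
  proof -
    have "W2 (\<nu> (u i)) (\<nu> (u (Suc i))) = \<bar>u i - u (Suc i)\<bar> * W2 (\<nu> 0) (\<nu> 1)"
      using geo u01[of i] u01[of "Suc i"] that unfolding constant_speed_geodesic_def
      by (meson Suc_leI less_imp_le)
    then show ?thesis by (simp add: power_mult_distrib w_def h_def power2_commute)
  qed
  obtain q :: "'a \<Rightarrow> nat" and c where q: "q \<in> measurable borel (count_space UNIV)"
    and c: "\<And>x. dist x (c (q x)) < \<delta>"
    using ex_quantizer[OF \<delta>(1)] by blast
  have cc1: "dist (c (q x)) (c (q y)) \<le> dist x y + 2 * \<delta>"
    and cc2: "dist x y \<le> dist (c (q x)) (c (q y)) + 2 * \<delta>" for x y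
    using c[of x] c[of y] by metric+
  have "\<exists>\<pi>. \<pi> \<in> couplings (\<nu> (u i)) (\<nu> (u (Suc i))) \<and> transport_cost \<pi> \<le> ennreal ((h i)\<^sup>2 * w + \<delta>)"
    if "i < n" for i
    using ex_near_optimal_coupling[OF P2[OF u01[of i]] P2[OF u01[of "Suc i"]] \<delta>(1)] that
    by (metis W2_step Suc_leI less_imp_le)
  then obtain \<pi> where \<pi>: "\<And>i. i < n \<Longrightarrow> \<pi> i \<in> couplings (\<nu> (u i)) (\<nu> (u (Suc i)))"
    and cost: "\<And>i. i < n \<Longrightarrow> transport_cost (\<pi> i) \<le> ennreal ((h i)\<^sup>2 * w + \<delta>)"
    by metis
  have \<pi>_prob: "prob_space (\<pi> i)" if "i < n" for i
    using couplings_prob_space[OF \<pi>[OF that]] P2_D(1)[OF P2[OF u01[of i]]] that by simp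
  have q_fst: "(\<lambda>z. q (fst z)) \<in> measurable (\<pi> i) (count_space UNIV)"
    and q_snd: "(\<lambda>z. q (snd z)) \<in> measurable (\<pi> i) (count_space UNIV)" if "i < n" for i
    using couplings_measurable_projections[OF \<pi>[OF that]] q by (auto intro: measurable_compose)
  have q_pair: "(\<lambda>z. (q (fst z), q (snd z))) \<in> measurable (\<pi> i) (count_space UNIV)" if "i < n" for i
    using measurable_Pair[OF q_fst[OF that] q_snd[OF that]]
    by (simp add: pair_measure_countable)
  have "\<exists>J. measure_pmf J = distr (\<pi> i) (count_space UNIV) (\<lambda>z. (q (fst z), q (snd z)))" if "i < n" for i
    using ex_pmf_of_law[OF \<pi>_prob[OF that] q_pair[OF that]] by blast
  then obtain J where J: "\<And>i. i < n \<Longrightarrow>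
      measure_pmf (J i) = distr (\<pi> i) (count_space UNIV) (\<lambda>z. (q (fst z), q (snd z)))"
    by metis
  have J1: "measure_pmf (map_pmf fst (J i)) = distr (\<nu> (u i)) (count_space UNIV) q" if "i < n" for i
  proof -
    have e: "distr (\<pi> i) borel fst = \<nu> (u i)" using \<pi>[OF that] by (simp add: couplings_def)
    have "measure_pmf (map_pmf fst (J i)) = distr (\<pi> i) (count_space UNIV) (\<lambda>z. q (fst z))"
      using q_pair[OF that] by (simp add: map_pmf_rep_eq J[OF that] distr_distr o_def)
    also have "\<dots> = distr (distr (\<pi> i) borel fst) (count_space UNIV) q"
      using q couplings_measurable_projections(1)[OF \<pi>[OF that]] by (simp add: distr_distr o_def)
    finally show ?thesis unfolding e .
  qed
  have J2: "measure_pmf (map_pmf snd (J i)) = distr (\<nu> (u (Suc i))) (count_space UNIV) q" if "i < n" for i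
  proof -
    have e: "distr (\<pi> i) borel snd = \<nu> (u (Suc i))" using \<pi>[OF that] by (simp add: couplings_def)
    have "measure_pmf (map_pmf snd (J i)) = distr (\<pi> i) (count_space UNIV) (\<lambda>z. q (snd z))"
      using q_pair[OF that] by (simp add: map_pmf_rep_eq J[OF that] distr_distr o_def)
    also have "\<dots> = distr (distr (\<pi> i) borel snd) (count_space UNIV) q"
      using q couplings_measurable_projections(2)[OF \<pi>[OF that]] by (simp add: distr_distr o_def)
    finally show ?thesis unfolding e .
  qed
  have "map_pmf snd (J i) = map_pmf fst (J (Suc i))" if "Suc i < n" for i
    using J1[OF that] J2[of i] that by (simp add: measure_pmf_inject[symmetric])
  then obtain P :: "(nat \<Rightarrow> nat) pmf" where P: "\<And>i. i < n \<Longrightarrow> map_pmf (\<lambda>f. (f i, f (Suc i))) P = J i"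
    using pmf_chain_gluing[of n J] by blast
  have n: "0 < n" using u by (cases n) auto
  have marg: "measure_pmf (map_pmf (\<lambda>f. f i) P) = distr (\<nu> (u i)) (count_space UNIV) q" if le: "i \<le> n" for i
  proof (cases "i < n")
    case True
    have "map_pmf (\<lambda>f. f i) P = map_pmf fst (map_pmf (\<lambda>f. (f i, f (Suc i))) P)"
      by (simp add: map_pmf_comp)
    then show ?thesis using J1[OF True] P[OF True] by simp
  next
    case False
    then obtain m where m: "i = Suc m" "m < n" using le n by (cases i) auto
    have "map_pmf (\<lambda>f. f i) P = map_pmf snd (map_pmf (\<lambda>f. (f m, f (Suc m))) P)"
      by (simp add: map_pmf_comp m)
    then show ?thesis using J2[OF m(2)] P[OF m(2)] m(1) by simp
  qed
  define d where "d f i = dist (c (f i)) (c (f (Suc i)))" for f i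
  define D where "D f = dist (c (f 0)) (c (f n))" for f
  define Z where "Z f = (\<Sum>i<n. (d f i)\<^sup>2 / h i) - (D f)\<^sup>2" for f
  have D_le: "D f \<le> (\<Sum>i<n. d f i)" for f
    using dist_chain_le[of 0 n "\<lambda>i. c (f i)"] by (simp add: D_def d_def atLeast0LessThan)
  have excess: "(\<Sum>i<n. h i * (d f i / h i - D f)\<^sup>2) \<le> Z f" for f
    unfolding Z_def by (rule chain_excess[OF h_pos h_sum _ D_le]) (simp_all add: D_def)
  have Z_nonneg: "0 \<le> Z f" for f
  proof -
    have "0 \<le> (\<Sum>i<n. h i * (d f i / h i - D f)\<^sup>2)"
      using h_pos by (intro sum_nonneg mult_nonneg_nonneg) (auto simp: less_imp_le)
    then show ?thesis using excess[of f] by linarith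
  qed
  have step_cost: "(\<integral>\<^sup>+ f. ennreal ((d f i)\<^sup>2) \<partial>measure_pmf P) \<le> ennreal ((h i)\<^sup>2 * w + (w + 10) * \<delta>)"
    if i: "i < n" for i
  proof -
    have "(\<integral>\<^sup>+ f. ennreal ((d f i)\<^sup>2) \<partial>measure_pmf P) =
          (\<integral>\<^sup>+ z. ennreal ((dist (c (fst z)) (c (snd z)))\<^sup>2) \<partial>measure_pmf (map_pmf (\<lambda>f. (f i, f (Suc i))) P))"
      by (simp add: d_def)
    also have "\<dots> = (\<integral>\<^sup>+ z. ennreal ((dist (c (q (fst z))) (c (q (snd z))))\<^sup>2) \<partial>\<pi> i)"
      unfolding P[OF i] J[OF i] using q_pair[OF i] by (subst nn_integral_distr) simp_all
    also have "\<dots> \<le> ennreal (1 + \<delta>) * (\<integral>\<^sup>+ z. ennreal ((dist (fst z) (snd z))\<^sup>2) \<partial>\<pi> i) + ennreal (8 * \<delta>)"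
      using \<delta> cc1 couplings_measurable_projections[OF \<pi>[OF i]]
      by (intro nn_integral_square_perturb[OF \<pi>_prob[OF i]]) (auto intro!: borel_measurable_dist)
    also have "\<dots> \<le> ennreal (1 + \<delta>) * ennreal ((h i)\<^sup>2 * w + \<delta>) + ennreal (8 * \<delta>)"
      using cost[OF i] by (intro add_right_mono mult_left_mono) (auto simp: transport_cost_def)
    also have "\<dots> = ennreal ((1 + \<delta>) * ((h i)\<^sup>2 * w + \<delta>) + 8 * \<delta>)"
      using \<delta> w by (simp add: ennreal_plus ennreal_mult')
    also have "\<dots> \<le> ennreal ((h i)\<^sup>2 * w + (w + 10) * \<delta>)"
    proof (rule ennreal_leI)
      have "(h i)\<^sup>2 * w \<le> w" using h1[OF i] h_pos[OF i] w
        by (simp add: mult_left_le_one_le power_le_one)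
      then have "\<delta> * ((h i)\<^sup>2 * w) \<le> \<delta> * w" using \<delta> by simp
      moreover have "\<delta> * \<delta> \<le> \<delta>" using \<delta> by (simp add: mult_left_le)
      ultimately show "(1 + \<delta>) * ((h i)\<^sup>2 * w + \<delta>) + 8 * \<delta> \<le> (h i)\<^sup>2 * w + (w + 10) * \<delta>"
        by (simp add: algebra_simps)
    qed
    finally show ?thesis .
  qed
  \<comment> \<open>\<open>Y + z\<close> is the expected value of \<open>\<Sum> d\<^sub>i\<^sup>2 / h\<^sub>i\<close>. It is at most \<open>w\<close> up to an error, while \<open>Y\<close> alone is
    at least \<open>w\<close> up to an error; hence the expected excess \<open>z\<close> is small.\<close>
  define Y where "Y = (\<integral>\<^sup>+ f. ennreal ((D f)\<^sup>2) \<partial>measure_pmf P)"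
  define z where "z = (\<integral>\<^sup>+ f. ennreal (Z f) \<partial>measure_pmf P)"
  have upper: "Y + z \<le> ennreal (w + H * (w + 10) * \<delta>)"
  proof -
    have "Y + z = (\<integral>\<^sup>+ f. ennreal ((D f)\<^sup>2) + ennreal (Z f) \<partial>measure_pmf P)"
      unfolding Y_def z_def by (rule nn_integral_add[symmetric]) simp_all
    also have "\<dots> = (\<integral>\<^sup>+ f. (\<Sum>i<n. ennreal (1 / h i) * ennreal ((d f i)\<^sup>2)) \<partial>measure_pmf P)"
    proof (rule nn_integral_cong)
      fix f
      have "ennreal ((D f)\<^sup>2) + ennreal (Z f) = ennreal (\<Sum>i<n. (d f i)\<^sup>2 / h i)"
        using Z_nonneg[of f] by (simp add: ennreal_plus[symmetric] Z_def del: ennreal_plus)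
      also have "\<dots> = (\<Sum>i<n. ennreal ((d f i)\<^sup>2 / h i))"
        using h_pos by (intro sum_ennreal[symmetric]) (simp add: less_imp_le)
      also have "\<dots> = (\<Sum>i<n. ennreal (1 / h i) * ennreal ((d f i)\<^sup>2))"
        using h_pos by (intro sum.cong refl) (simp add: ennreal_mult'[symmetric] less_imp_le)
      finally show "ennreal ((D f)\<^sup>2) + ennreal (Z f) = (\<Sum>i<n. ennreal (1 / h i) * ennreal ((d f i)\<^sup>2))" .
    qed
    also have "\<dots> = (\<Sum>i<n. ennreal (1 / h i) * (\<integral>\<^sup>+ f. ennreal ((d f i)\<^sup>2) \<partial>measure_pmf P))"
      by (simp add: nn_integral_sum nn_integral_cmult)
    also have "\<dots> \<le> (\<Sum>i<n. ennreal (1 / h i) * ennreal ((h i)\<^sup>2 * w + (w + 10) * \<delta>))"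
      using step_cost by (intro sum_mono mult_left_mono) auto
    also have "\<dots> = (\<Sum>i<n. ennreal (h i * w + (w + 10) * \<delta> * (1 / h i)))"
    proof (intro sum.cong refl)
      fix i assume "i \<in> {..<n}"
      then have h0: "0 < h i" using h_pos by simp
      have e: "1 / h i * (h i)\<^sup>2 = h i" using h0 by (simp add: power2_eq_square)
      have "1 / h i * ((h i)\<^sup>2 * w + (w + 10) * \<delta>) = h i * w + (w + 10) * \<delta> * (1 / h i)"
        unfolding distrib_left[of "1 / h i" "(h i)\<^sup>2 * w" "(w + 10) * \<delta>"] mult.assoc[symmetric] e by (simp only: mult_ac)
      then show "ennreal (1 / h i) * ennreal ((h i)\<^sup>2 * w + (w + 10) * \<delta>) =
          ennreal (h i * w + (w + 10) * \<delta> * (1 / h i))"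
        using h0 by (subst ennreal_mult'[symmetric]) simp_all
    qed
    also have "\<dots> = ennreal (\<Sum>i<n. h i * w + (w + 10) * \<delta> * (1 / h i))"
      using h_pos w \<delta> by (intro sum_ennreal) (simp add: less_imp_le)
    also have "(\<Sum>i<n. h i * w + (w + 10) * \<delta> * (1 / h i)) = w + H * (w + 10) * \<delta>"
      unfolding sum.distrib sum_distrib_right[symmetric] sum_distrib_left[symmetric] h_sum H_def
      by simp
    finally show ?thesis .
  qed
  have lower: "ennreal w \<le> ennreal (1 + \<delta>) * Y + ennreal (8 * \<delta>)"
  proof -
    define PE where "PE = map_pmf (\<lambda>f. (f 0, f n)) P"
    have "measure_pmf (map_pmf fst PE) = distr (\<nu> 0) (count_space UNIV) q"
      "measure_pmf (map_pmf snd PE) = distr (\<nu> 1) (count_space UNIV) q"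
      using marg[of 0] marg[of n] u by (simp_all add: PE_def map_pmf_comp)
    then obtain \<rho> where \<rho>: "\<rho> \<in> couplings (\<nu> 0) (\<nu> 1)"
      and \<rho>q: "\<And>g. (\<integral>\<^sup>+ z. g (q (fst z), q (snd z)) \<partial>\<rho>) = (\<integral>\<^sup>+ w. g w \<partial>measure_pmf PE)"
      using lift_discrete_coupling[OF P2_D[OF P2[of 0]] P2_D[OF P2[of 1]] q, of PE] by auto
    have \<rho>_prob: "prob_space \<rho>" using couplings_prob_space[OF \<rho>] P2_D(1)[OF P2[of 0]] by simp
    have [measurable]: "(\<lambda>z. q (fst z)) \<in> measurable \<rho> (count_space UNIV)"
      "(\<lambda>z. q (snd z)) \<in> measurable \<rho> (count_space UNIV)"
      using couplings_measurable_projections[OF \<rho>] q by (auto intro: measurable_compose)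
    have "ennreal w \<le> transport_cost \<rho>"
      unfolding w_def using P2 \<rho> by (intro W2_square_le_cost) auto
    also have "\<dots> \<le> ennreal (1 + \<delta>) * (\<integral>\<^sup>+ z. ennreal ((dist (c (q (fst z))) (c (q (snd z))))\<^sup>2) \<partial>\<rho>)
        + ennreal (8 * \<delta>)"
      unfolding transport_cost_def using \<delta> cc2
      by (intro nn_integral_square_perturb[OF \<rho>_prob]) auto
    also have "(\<integral>\<^sup>+ z. ennreal ((dist (c (q (fst z))) (c (q (snd z))))\<^sup>2) \<partial>\<rho>) = Y"
      using \<rho>q[of "\<lambda>z. ennreal ((dist (c (fst z)) (c (snd z)))\<^sup>2)"]
      by (simp add: Y_def PE_def D_def)
    finally show ?thesis .
  qed
  have z_le: "z \<le> ennreal (\<eta> ^ 3)"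
  proof -
    have fin: "Y < top" "z < top"
      using upper by (auto simp: top_unique less_top[symmetric] ennreal_add_eq_top intro: le_less_trans)
    define y' z' where "y' = enn2real Y" and "z' = enn2real z"
    have Y: "Y = ennreal y'" and z: "z = ennreal z'" and nn: "0 \<le> y'" "0 \<le> z'"
      using fin by (simp_all add: y'_def z'_def)
    have K: "0 \<le> w + H * (w + 10) * \<delta>" using w H \<delta> by simp
    have 1: "y' + z' \<le> w + H * (w + 10) * \<delta>"
      using upper nn K unfolding Y z by (simp add: ennreal_plus[symmetric] del: ennreal_plus)
    have 2: "w \<le> (1 + \<delta>) * y' + 8 * \<delta>"
      using lower nn \<delta> unfolding Y
      by (simp add: ennreal_plus[symmetric] ennreal_mult'[symmetric] del: ennreal_plus)
    have "\<delta> * y' \<le> \<delta> * (w + H * (w + 10))"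
    proof (rule mult_left_mono)
      have "H * (w + 10) * \<delta> \<le> H * (w + 10)" using \<delta> w H by (intro mult_left_le) auto
      then show "y' \<le> w + H * (w + 10)" using 1 nn by linarith
    qed (use \<delta> in simp)
    then have "z' \<le> \<delta> * C" using 1 2 unfolding C_def by (simp add: algebra_simps)
    then show ?thesis unfolding z using \<delta>C by (intro ennreal_leI) simp
  qed
  define B where "B = {f. \<exists>i<n. d f i > h i * D f + \<eta>}"
  have "ennreal (\<eta>\<^sup>2) * emeasure P B \<le> z"
  proof -
    have "ennreal (\<eta>\<^sup>2) * emeasure P B = (\<integral>\<^sup>+ f. ennreal (\<eta>\<^sup>2) * indicator B f \<partial>measure_pmf P)"
      by (simp add: nn_integral_cmult)
    also have "\<dots> \<le> z"
      unfolding z_def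
    proof (rule nn_integral_mono)
      fix f
      show "ennreal (\<eta>\<^sup>2) * indicator B f \<le> ennreal (Z f)"
      proof (cases "f \<in> B")
        case True
        then obtain i where i: "i < n" "h i * D f + \<eta> < d f i" by (auto simp: B_def)
        have "\<eta>\<^sup>2 \<le> (d f i - h i * D f)\<^sup>2" using i pos by (intro power_mono) auto
        also have "\<dots> \<le> (d f i - h i * D f)\<^sup>2 / h i"
          using h1[OF i(1)] h_pos[OF i(1)] by (simp add: le_divide_eq mult_left_le)
        also have "\<dots> = h i * (d f i / h i - D f)\<^sup>2"
          using h_pos[OF i(1)] by (simp add: power2_eq_square field_simps)
        also have "\<dots> \<le> (\<Sum>i<n. h i * (d f i / h i - D f)\<^sup>2)"
          using i h_pos by (intro member_le_sum) (auto simp: less_imp_le)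
        also have "\<dots> \<le> Z f" by (rule excess)
        finally show ?thesis using True by (simp add: ennreal_leI)
      qed simp
    qed
    finally show ?thesis .
  qed
  then have "ennreal (\<eta>\<^sup>2 * measure P B) \<le> ennreal (\<eta> ^ 3)"
    using z_le by (simp add: measure_pmf.emeasure_eq_measure ennreal_mult')
  then have "\<eta>\<^sup>2 * measure P B \<le> \<eta>\<^sup>2 * \<eta>"
    using pos by (simp add: power2_eq_square power3_eq_cube mult.assoc)
  then have "measure P B \<le> \<eta>" using pos by simp
  then show thesis
    using that[OF \<delta>(1,3) q c marg] unfolding B_def d_def D_def h_def by simp
qed

text \<open>
  The times now come in any order and may repeat, as happens when the intermediate time is an end point. They are
  sorted to apply the previous lemma, and the one-step bounds are summed along the sorted grid. Only upper bounds on
  distances are kept: on an exact chain they force equality by the triangle inequality.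
\<close>

lemma ex_discrete_geodesic_law_family:
  fixes \<nu> :: "real \<Rightarrow> 'a::polish_space measure" and s :: "nat \<Rightarrow> real"
  assumes geo: "constant_speed_geodesic W2 \<nu>" and P2: "\<And>t. t \<in> {0..1} \<Longrightarrow> \<nu> t \<in> P2"
    and s: "s 0 = 0" "s 1 = 1" "\<And>i. i < n \<Longrightarrow> s i \<in> {0..1}" and n: "2 \<le> n"
    and pos: "0 < e" "0 < \<epsilon>"
  obtains \<delta> :: real and q :: "'a \<Rightarrow> nat" and c :: "nat \<Rightarrow> 'a" and P :: "(nat \<Rightarrow> nat) pmf"
  where "0 < \<delta>" "\<delta> \<le> e" "q \<in> measurable borel (count_space UNIV)" "\<And>x. dist x (c (q x)) < \<delta>"
    "\<And>i. i < n \<Longrightarrow> measure_pmf (map_pmf (\<lambda>f. f i) P) = distr (\<nu> (s i)) (count_space UNIV) q"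
    "measure P {f. \<exists>i<n. \<exists>j<n. dist (c (f i)) (c (f j)) >
        \<bar>s i - s j\<bar> * dist (c (f 0)) (c (f 1)) + e} \<le> \<epsilon>"
proof -
  define F where "F = s ` {..<n}"
  define L where "L = sorted_list_of_set F"
  define m where "m = length L - 1"
  have F: "finite F" "0 \<in> F" "1 \<in> F" "F \<subseteq> {0..1}"
    using s n by (auto simp: F_def image_iff intro: bexI[of _ 0] bexI[of _ 1])
  have setL: "set L = F" using F by (simp add: L_def)
  then have len: "length L = Suc m" using F by (cases L) (auto simp: m_def)
  have u: "L ! i < L ! j" if "i < j" "j \<le> m" for i j
    using strict_sorted_list_of_set[of F] that len unfolding L_def[symmetric]
    by (simp add: sorted_wrt_nth_less)
  have u_in: "L ! i \<in> {0..1}" if "i \<le> m" for i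
    using nth_mem[of i L] that len setL F(4) by auto
  have u0: "L ! 0 = 0"
  proof -
    obtain k where "k \<le> m" "L ! k = 0" using F(2) len unfolding setL[symmetric] in_set_conv_nth
      by (auto simp: less_Suc_eq_le)
    then show ?thesis using u[of 0 k] u_in[of 0] by (cases "k = 0") auto
  qed
  have u1: "L ! m = 1"
  proof -
    obtain k where "k \<le> m" "L ! k = 1" using F(3) len unfolding setL[symmetric] in_set_conv_nth
      by (auto simp: less_Suc_eq_le)
    then show ?thesis using u[of k m] u_in[of m] by (cases "k = m") auto
  qed
  have "\<exists>k. k \<le> m \<and> L ! k = s j" if "j < n" for j
  proof -
    have "s j \<in> set L" using that by (simp add: setL F_def)
    then show ?thesis using len by (auto simp: in_set_conv_nth less_Suc_eq_le)
  qed
  then obtain a where a: "\<And>j. j < n \<Longrightarrow> a j \<le> m" "\<And>j. j < n \<Longrightarrow> L ! (a j) = s j" by metis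
  have u_step: "L ! i < L ! Suc i" if "i < m" for i using u[of i "Suc i"] that by simp
  have u_inj: "i = j" if "L ! i = L ! j" "i \<le> m" "j \<le> m" for i j
    using u[of i j] u[of j i] that by (metis less_irrefl linorder_neqE_nat)
  have a01: "a 0 = 0" "a 1 = m"
    using u_inj[of "a 0" 0] u_inj[of "a 1" m] a[of 0] a[of 1] s(1,2) n u0 u1 by auto
  \<comment> \<open>A distance is the sum of at most \<open>m\<close> steps, each with error \<open>\<eta>\<close>.\<close>
  define \<eta> where "\<eta> = min \<epsilon> (e / Suc m)"
  have \<eta>: "0 < \<eta>" "\<eta> \<le> \<epsilon>" using pos by (simp_all add: \<eta>_def)
  have "\<eta> \<le> e / Suc m" by (simp add: \<eta>_def)
  then have "\<eta> * Suc m \<le> e" by (simp add: pos_le_divide_eq)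
  then have m\<eta>: "m * \<eta> \<le> e" using \<eta>(1) by (simp add: algebra_simps)
  obtain \<delta> and q :: "'a \<Rightarrow> nat" and c and P :: "(nat \<Rightarrow> nat) pmf" where
    \<delta>: "0 < \<delta>" "\<delta> \<le> e" and q: "q \<in> measurable borel (count_space UNIV)" "\<And>x. dist x (c (q x)) < \<delta>"
    and marg: "\<And>i. i \<le> m \<Longrightarrow> measure_pmf (map_pmf (\<lambda>f. f i) P) = distr (\<nu> (L ! i)) (count_space UNIV) q"
    and bad: "measure P {f. \<exists>i<m. dist (c (f i)) (c (f (Suc i))) >
        (L ! Suc i - L ! i) * dist (c (f 0)) (c (f m)) + \<eta>} \<le> \<eta>" (is "measure P ?bad \<le> \<eta>")
    by (rule ex_discrete_geodesic_law[OF geo P2 u_step u0 u1 \<eta>(1) pos(1)])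
      (assumption | (rule that; (assumption | simp)))+
  define Q where "Q = map_pmf (\<lambda>f j. f (a j)) P"
  have margQ: "measure_pmf (map_pmf (\<lambda>f. f i) Q) = distr (\<nu> (s i)) (count_space UNIV) q" if "i < n" for i
    using marg[OF a(1)[OF that]] a(2)[OF that] by (simp add: Q_def map_pmf_comp)
  have near: "dist (c (f i)) (c (f j)) \<le> (L ! j - L ! i) * dist (c (f 0)) (c (f m)) + e"
    if f: "f \<notin> ?bad" and ij: "i \<le> j" "j \<le> m" for f i j
  proof -
    have "dist (c (f i)) (c (f j)) \<le> (\<Sum>k=i..<j. dist (c (f k)) (c (f (Suc k))))"
      by (rule dist_chain_le[OF ij(1)])
    also have "\<dots> \<le> (\<Sum>k=i..<j. (L ! Suc k - L ! k) * dist (c (f 0)) (c (f m)) + \<eta>)"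
    proof (rule sum_mono)
      fix k assume "k \<in> {i..<j}"
      then have "k < m" using ij(2) by simp
      show "dist (c (f k)) (c (f (Suc k))) \<le> (L ! Suc k - L ! k) * dist (c (f 0)) (c (f m)) + \<eta>"
      proof (rule ccontr)
        assume "\<not> ?thesis"
        then have "f \<in> ?bad" using \<open>k < m\<close> by auto
        with f show False by blast
      qed
    qed
    also have "\<dots> = (L ! j - L ! i) * dist (c (f 0)) (c (f m)) + (j - i) * \<eta>"
      using ij(1) by (simp add: sum.distrib sum_distrib_right[symmetric] sum_Suc_diff')
    also have "(j - i) * \<eta> \<le> m * \<eta>" using ij \<eta> by (intro mult_right_mono) auto
    finally show ?thesis using m\<eta> by simp
  qed
  have "measure Q {f. \<exists>i<n. \<exists>j<n. dist (c (f i)) (c (f j)) >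
        \<bar>s i - s j\<bar> * dist (c (f 0)) (c (f 1)) + e} \<le> measure P ?bad"
    unfolding Q_def measure_map_pmf
  proof (rule measure_pmf.finite_measure_mono)
    show "(\<lambda>f j. f (a j)) -` {f. \<exists>i<n. \<exists>j<n. dist (c (f i)) (c (f j)) >
        \<bar>s i - s j\<bar> * dist (c (f 0)) (c (f 1)) + e} \<subseteq> ?bad"
    proof (rule subsetI, rule ccontr)
      fix f
      assume "f \<in> (\<lambda>f j. f (a j)) -` {f. \<exists>i<n. \<exists>j<n. dist (c (f i)) (c (f j)) >
        \<bar>s i - s j\<bar> * dist (c (f 0)) (c (f 1)) + e}"
      then obtain i j where ij: "i < n" "j < n" "dist (c (f (a i))) (c (f (a j))) >
        \<bar>s i - s j\<bar> * dist (c (f 0)) (c (f m)) + e"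
        by (auto simp: a01 a01(2)[unfolded One_nat_def])
      assume f: "f \<notin> ?bad"
      consider "a i \<le> a j" | "a j \<le> a i" by linarith
      then have "dist (c (f (a i))) (c (f (a j))) \<le> \<bar>s i - s j\<bar> * dist (c (f 0)) (c (f m)) + e"
      proof cases
        case 1
        have "s i \<le> s j" using u[of "a i" "a j"] a(1)[OF ij(2)] a(2)[OF ij(1)] a(2)[OF ij(2)] 1
          by (cases "a i = a j") auto
        then show ?thesis using near[OF f 1 a(1)[OF ij(2)]] a(2) ij by simp
      next
        case 2
        have "s j \<le> s i" using u[of "a j" "a i"] a(1)[OF ij(1)] a(2)[OF ij(1)] a(2)[OF ij(2)] 2
          by (cases "a i = a j") auto
        then show ?thesis using near[OF f 2 a(1)[OF ij(1)]] a(2) ij by (simp add: dist_commute)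
      qed
      then show False using ij by simp
    qed
  qed simp
  also have "\<dots> \<le> \<epsilon>" using bad \<eta> by simp
  finally have fin: "measure Q {f. \<exists>i<n. \<exists>j<n. dist (c (f i)) (c (f j)) >
        \<bar>s i - s j\<bar> * dist (c (f 0)) (c (f 1)) + e} \<le> \<epsilon>" .
  show thesis by (rule that[OF \<delta> q]) (erule margQ, rule fin)
qed

section \<open>From chains to geodesics\<close>

text \<open>
  The hypothesis makes the chain Lipschitz in time, with constant \<open>D\<close> the distance of its ends, so it extends to
  \<open>[0,1]\<close> by completeness. A curve whose Lipschitz constant equals the distance of its ends is a geodesic: a strict
  inequality anywhere would make the way from end to end too short.
\<close>

lemma geodesic_through_dense_times:
  fixes s :: "nat \<Rightarrow> real" and x :: "nat \<Rightarrow> 'a::complete_space"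
  assumes s: "s 0 = 0" "s 1 = 1" "{0..1} \<subseteq> closure (range s)" "range s \<subseteq> {0..1}"
    and x: "\<And>i j. dist (x i) (x j) \<le> \<bar>s i - s j\<bar> * dist (x 0) (x 1)"
  obtains \<gamma> where "\<gamma> \<in> geodesics" "\<And>i. \<gamma> (s i) = x i"
proof -
  define D where "D = dist (x 0) (x 1)"
  define f where "f r = x (SOME j. s j = r)" for r
  have f: "f (s i) = x i" for i
  proof -
    have "s (SOME j. s j = s i) = s i" by (rule someI[of _ i]) simp
    then show ?thesis using x[of "SOME j. s j = s i" i] by (simp add: f_def)
  qed
  have "D-lipschitz_on (range s) f"
  proof (rule lipschitz_onI)
    fix a b assume "a \<in> range s" "b \<in> range s"
    then show "dist (f a) (f b) \<le> D * dist a b"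
      using x by (auto simp: f D_def dist_real_def mult.commute)
  qed (simp add: D_def)
  then obtain g where g: "D-lipschitz_on (closure (range s)) g" "\<And>r. r \<in> range s \<Longrightarrow> g r = f r"
    using lipschitz_extend_closure by blast
  have g_lip: "dist (g a) (g b) \<le> \<bar>a - b\<bar> * D" if "a \<in> {0..1}" "b \<in> {0..1}" for a b
    using lipschitz_onD[OF g(1) subsetD[OF s(3) that(1)] subsetD[OF s(3) that(2)]]
    by (simp add: dist_real_def mult.commute)
  have gs: "g (s i) = x i" for i using g(2) f by simp
  have g01: "dist (g 0) (g 1) = D" using gs[of 0] gs[of 1] s by (simp add: D_def)
  have g_ge: "(b - a) * D \<le> dist (g a) (g b)" if "a \<in> {0..1}" "b \<in> {0..1}" "a \<le> b" for a b
  proof -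
    have "D \<le> dist (g 0) (g a) + dist (g a) (g b) + dist (g b) (g 1)"
      unfolding g01[symmetric] by metric
    also have "\<dots> \<le> a * D + dist (g a) (g b) + (1 - b) * D"
      using g_lip[of 0 a] g_lip[of b 1] that by simp
    finally show ?thesis by (simp add: algebra_simps)
  qed
  have g_eq: "dist (g a) (g b) = \<bar>a - b\<bar> * dist (g 0) (g 1)" if "a \<in> {0..1}" "b \<in> {0..1}" for a b
  proof (cases "a \<le> b")
    case True
    then show ?thesis using g_lip[OF that] g_ge[OF that] by (simp add: g01)
  next
    case False
    then show ?thesis using g_lip[OF that] g_ge[OF that(2,1)]
      by (simp add: g01 dist_commute[of "g a"])
  qed
  define \<gamma> where "\<gamma> = restrict g {0..1}"
  have "\<gamma> \<in> geodesics"
    unfolding geodesics_def constant_speed_geodesic_def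
  proof (intro CollectI conjI ballI)
    fix a b :: real assume ab: "a \<in> {0..1}" "b \<in> {0..1}"
    show "dist (\<gamma> a) (\<gamma> b) = \<bar>a - b\<bar> * dist (\<gamma> 0) (\<gamma> 1)"
      using g_eq[OF ab] ab by (simp add: \<gamma>_def)
  qed (simp add: \<gamma>_def)
  moreover have "\<gamma> (s i) = x i" for i
    using subsetD[OF s(4) rangeI[of s i]] gs by (simp add: \<gamma>_def)
  ultimately show thesis by (rule that)
qed

text \<open>
  The prescribed positions of \<open>0\<close>, \<open>1\<close> and \<open>t\<close> let the finite chains below refer to them by index.
\<close>

lemma ex_dense_times:
  assumes "t \<in> {0..1::real}"
  obtains s :: "nat \<Rightarrow> real" where "s 0 = 0" "s 1 = 1" "s 2 = t" "{0..1} \<subseteq> closure (range s)"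
    "range s \<subseteq> {0..1}"
proof -
  define R where "R = \<rat> \<inter> {0..1::real}"
  define s where "s j = (if j = 0 then 0 else if j = 1 then 1 else if j = 2 then t
      else from_nat_into R (j - 3))" for j
  have R: "countable R" "R \<noteq> {}" by (auto simp: R_def countable_rat intro: exI[of _ 0])
  have "range s \<subseteq> {0..1}"
    using from_nat_into[OF R(2)] assms by (auto simp: s_def R_def)
  moreover have "R \<subseteq> range s"
  proof
    fix r assume "r \<in> R"
    then obtain k where "from_nat_into R k = r" using from_nat_into_surj[OF R(1)] by blast
    then have "s (k + 3) = r" by (simp add: s_def)
    then show "r \<in> range s" by blast
  qed
  moreover have "{0..1} \<subseteq> closure R"
  proof
    fix r :: real assume r: "r \<in> {0..1}"
    show "r \<in> closure R"
      unfolding closure_approachable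
    proof (intro allI impI)
      fix e :: real assume "0 < e"
      then have "max 0 (r - e) < min 1 (r + e)" using r by auto
      then obtain z where "z \<in> \<rat>" "max 0 (r - e) < z" "z < min 1 (r + e)"
        using Rats_dense_in_real by blast
      then show "\<exists>y\<in>R. dist y r < e"
        by (intro bexI[of _ z]) (auto simp: R_def dist_real_def)
    qed
  qed
  ultimately show thesis
    using that[of s] closure_mono[of R "range s"] by (simp add: s_def)
qed

lemma inner_compact_full_measure:
  fixes \<mu> :: "'a::polish_space measure"
  assumes \<mu>: "prob_space \<mu>" "sets \<mu> = sets borel" and C: "C \<in> sets borel" "measure \<mu> C = 1" and "0 < e"
  obtains K where "compact K" "K \<subseteq> C" "measure \<mu> (- K) \<le> e"
proof -
  interpret prob_space \<mu> by fact
  have sp: "space \<mu> = UNIV" using \<mu>(2) by (auto dest: sets_eq_imp_space_eq)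
  have "ennreal (1 - e) < emeasure \<mu> C"
    using C assms(5) by (simp add: emeasure_eq_measure ennreal_less_one_iff)
  also have "emeasure \<mu> C = (SUP K \<in> {K. K \<subseteq> C \<and> compact K}. emeasure \<mu> K)"
    by (rule inner_regular[OF \<mu>(2) _ C(1)]) (simp add: emeasure_eq_measure)
  finally obtain K where K: "K \<subseteq> C" "compact K" "ennreal (1 - e) < emeasure \<mu> K"
    by (auto simp: less_SUP_iff)
  have Ks: "K \<in> sets \<mu>" using K(2) by (simp add: \<mu>(2) borel_closed compact_imp_closed)
  have "1 - e \<le> measure \<mu> K"
    using K(3) by (cases "0 \<le> 1 - e") (auto simp: emeasure_eq_measure ennreal_less_iff intro: order_trans[OF _ measure_nonneg])
  then have "measure \<mu> (- K) \<le> e"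
    using prob_compl[OF Ks] by (simp add: sp Compl_eq_Diff_UNIV)
  then show thesis using K by (intro that)
qed

lemma compact_product_of_compacts:
  fixes K :: "'i \<Rightarrow> 'a::topological_space set"
  assumes "\<And>i. compact (K i)"
  shows "compact {x. \<forall>i. x i \<in> K i}"
proof -
  have "compactin (product_topology (\<lambda>i. euclidean) UNIV) (PiE UNIV K)"
    unfolding compactin_PiE using assms by simp
  moreover have "PiE UNIV K = {x. \<forall>i. x i \<in> K i}" by (auto simp: PiE_def)
  ultimately show ?thesis by (simp add: euclidean_product_topology)
qed

text \<open>
  The error \<open>1 / (n + 1)\<close> decreases as more times are prescribed, which makes these sets decrease. The coordinates from \<open>n\<close>
  on are confined to the sets \<open>K j\<close> but otherwise free, so that all these sets live in one compact product.
\<close>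

definition approx_chains :: "(nat \<Rightarrow> 'a::metric_space set) \<Rightarrow> (nat \<Rightarrow> real) \<Rightarrow> nat \<Rightarrow> (nat \<Rightarrow> 'a) set" where
  "approx_chains K s n = {x. (\<forall>j. x j \<in> K j) \<and>
     (\<forall>i<n. \<forall>j<n. dist (x i) (x j) \<le> \<bar>s i - s j\<bar> * dist (x 0) (x 1) + inverse (Suc n))}"

lemma approx_chains_mono: "m \<le> n \<Longrightarrow> approx_chains K s n \<subseteq> approx_chains K s m"
proof
  fix x assume mn: "m \<le> n" and x: "x \<in> approx_chains K s n"
  have "inverse (real (Suc n)) \<le> inverse (real (Suc m))" using mn by (intro le_imp_inverse_le) auto
  then show "x \<in> approx_chains K s m"
    using x mn unfolding approx_chains_def by (smt (verit, best) mem_Collect_eq order_less_le_trans)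
qed

lemma compact_approx_chains:
  fixes K :: "nat \<Rightarrow> 'a::metric_space set"
  assumes "\<And>i. compact (K i)"
  shows "compact (approx_chains K s n)"
proof -
  have "closed {x :: nat \<Rightarrow> 'a. dist (x i) (x j) \<le> \<bar>s i - s j\<bar> * dist (x 0) (x 1) + inverse (Suc n)}" for i j
    by (intro closed_Collect_le continuous_on_add continuous_on_mult continuous_on_dist
        continuous_on_const continuous_on_product_coordinates)
  then have "closed (\<Inter>i\<in>{..<n}. \<Inter>j\<in>{..<n}. {x :: nat \<Rightarrow> 'a.
      dist (x i) (x j) \<le> \<bar>s i - s j\<bar> * dist (x 0) (x 1) + inverse (Suc n)})"
    by (intro closed_INT ballI)
  from compact_Int_closed[OF compact_product_of_compacts[of K, OF assms] this]
  show ?thesis by (rule back_subst[of compact]) (auto simp: approx_chains_def)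
qed

text \<open>
  Projection commutes with the intersection of these decreasing compact sets, by the finite intersection property
  in the fibre over \<open>y\<close>. This is what replaces the construction of a measure on paths.
\<close>

lemma Inter_projection_approx_chains:
  fixes K :: "nat \<Rightarrow> 'a::metric_space set"
  assumes K: "\<And>i. compact (K i)" and y: "\<And>n. y \<in> (\<lambda>x. x m) ` approx_chains K s n"
  obtains x where "x m = y" "\<And>j. x j \<in> K j"
    "\<And>i j. dist (x i) (x j) \<le> \<bar>s i - s j\<bar> * dist (x 0) (x 1)"
proof -
  let ?G = "\<lambda>n. approx_chains K s n \<inter> {x. x m = y}"
  have cl: "closed {x :: nat \<Rightarrow> 'a. x m = y}"
    by (intro closed_Collect_eq continuous_on_product_coordinates continuous_on_const)
  have "?G 0 \<inter> (\<Inter>n\<in>UNIV. ?G n) \<noteq> {}"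
  proof (rule compact_imp_fip_image)
    show "compact (?G 0)" by (intro compact_Int_closed compact_approx_chains K cl)
    show "closed (?G n)" for n
      by (intro closed_Int compact_imp_closed compact_approx_chains K cl)
    fix I :: "nat set" assume I: "finite I"
    obtain x where x: "x \<in> approx_chains K s (Max (insert 0 I))" "x m = y" using y by fast
    have "x \<in> ?G n" if "n \<in> insert 0 I" for n
      using approx_chains_mono[of n "Max (insert 0 I)" K s] x I that by auto
    then show "?G 0 \<inter> (\<Inter>n\<in>I. ?G n) \<noteq> {}" by blast
  qed
  then obtain x where x: "\<And>n. x \<in> approx_chains K s n" "x m = y" by auto
  have "dist (x i) (x j) \<le> \<bar>s i - s j\<bar> * dist (x 0) (x 1)" for i j
  proof (rule field_le_epsilon)
    fix e :: real assume "0 < e"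
    then obtain k where k: "inverse (real (Suc k)) < e" using reals_Archimedean by blast
    define n where "n = Max {i, j, k} + 1"
    have n: "i < n" "j < n" "k \<le> n" by (auto simp: n_def)
    have "dist (x i) (x j) \<le> \<bar>s i - s j\<bar> * dist (x 0) (x 1) + inverse (Suc n)"
      using x(1)[of n] n unfolding approx_chains_def by blast
    moreover have "inverse (real (Suc n)) \<le> inverse (real (Suc k))" using n(3) by (intro le_imp_inverse_le) auto
    ultimately show "dist (x i) (x j) \<le> \<bar>s i - s j\<bar> * dist (x 0) (x 1) + e" using k by linarith
  qed
  moreover have "x j \<in> K j" for j using x(1)[of 0] by (simp add: approx_chains_def)
  ultimately show thesis using x(2) that by blast
qed

lemma sum_halves_le: "(\<Sum>j<n. (1 / 2) ^ Suc j) \<le> (1 :: real)"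
proof -
  have "(\<Sum>j<n. (1 / 2) ^ Suc j) = 1 - (1 / 2 :: real) ^ n" by (induction n) (auto simp: field_simps)
  then show ?thesis by simp
qed

lemma mult_half_power_le: "0 \<le> \<epsilon> \<Longrightarrow> \<epsilon> * (1 / 2) ^ k \<le> (\<epsilon> :: real)"
  by (simp add: mult_left_le power_le_one)

text \<open>
  A random chain of cells is good if it is nearly geodesic and each of its cells meets the compact set of its time.
  Any choice of points of \<open>K j\<close> in the cells of a good chain is an approximate chain, with the point at the time of
  index \<open>m\<close> still arbitrary. Three events may fail, each with probability at most \<open>\<epsilon>\<close>: near-geodesicity, meeting the
  compact sets, and the point at index \<open>m\<close> lying in its compact set.
\<close>

lemma projection_approx_chains_mass:
  fixes \<nu> :: "real \<Rightarrow> 'a::polish_space measure"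
  assumes geo: "constant_speed_geodesic W2 \<nu>" and P2: "\<And>t. t \<in> {0..1} \<Longrightarrow> \<nu> t \<in> P2"
    and s: "s 0 = 0" "s 1 = 1" "\<And>i. s i \<in> {0..1}"
    and K: "\<And>j. compact (K j)" "\<And>j. measure (\<nu> (s j)) (- K j) \<le> \<epsilon> * (1 / 2) ^ Suc j"
    and \<epsilon>: "0 < \<epsilon>" "\<epsilon> < 1" and m: "m < n" and n: "2 \<le> n"
  shows "1 - 3 * \<epsilon> \<le> measure (\<nu> (s m)) ((\<lambda>x. x m) ` approx_chains K s n)"
proof -
  \<comment> \<open>The error \<open>e\<close> of the chain of centres enters once, and the cell size \<open>\<delta> \<le> e\<close> four times: twice each for replacing the
    centres by points on the two sides of the inequality.\<close>
  define e where "e = inverse (real (Suc n)) / 5"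
  have e: "0 < e" by (simp add: e_def)
  obtain \<delta> :: real and q :: "'a \<Rightarrow> nat" and c :: "nat \<Rightarrow> 'a" and P :: "(nat \<Rightarrow> nat) pmf"
    where \<delta>: "0 < \<delta>" "\<delta> \<le> e" and q: "q \<in> measurable borel (count_space UNIV)"
    and c: "\<And>x. dist x (c (q x)) < \<delta>"
    and marg: "\<And>i. i < n \<Longrightarrow> measure_pmf (map_pmf (\<lambda>f. f i) P) = distr (\<nu> (s i)) (count_space UNIV) q"
    and bad: "measure P {f. \<exists>i<n. \<exists>j<n. dist (c (f i)) (c (f j)) >
        \<bar>s i - s j\<bar> * dist (c (f 0)) (c (f 1)) + e} \<le> \<epsilon>" (is "measure P ?bad \<le> _")
    by (rule ex_discrete_geodesic_law_family[OF geo P2 s n e \<epsilon>(1)])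
      (assumption | (rule that; (assumption | simp)))+
  have prob: "prob_space (\<nu> (s j))" and sets: "sets (\<nu> (s j)) = sets borel" for j
    using P2_D[OF P2[OF s(3)]] by simp_all
  have sp: "space (\<nu> (s j)) = UNIV" for j using sets_eq_imp_space_eq[OF sets] by simp
  have q': "q \<in> measurable (\<nu> (s j)) (count_space UNIV)" for j
    using q unfolding measurable_cong_sets[OF sets refl] .
  have vimage: "q -` S \<in> sets (\<nu> (s j))" for S j
    using measurable_sets[OF q', of S] by (simp add: sp)
  have Ks: "K j \<in> sets (\<nu> (s i))" for i j
    using K(1)[of j] by (simp add: sets borel_closed compact_imp_closed)
  have transfer: "measure P {f. f j \<in> S} = measure (\<nu> (s j)) (q -` S)" if "j < n" for j S
  proof -
    have "measure P {f. f j \<in> S} = measure (measure_pmf (map_pmf (\<lambda>f. f j) P)) S"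
      by (simp add: vimage_def)
    also have "\<dots> = measure (\<nu> (s j)) (q -` S)"
      unfolding marg[OF that] using q' by (simp add: measure_distr sp)
    finally show ?thesis .
  qed
  define miss where "miss j = {f :: nat \<Rightarrow> nat. f j \<in> - q ` K j}" for j
  have miss: "measure P (miss j) \<le> \<epsilon> * (1 / 2) ^ Suc j" if "j < n" for j
  proof -
    interpret prob_space "\<nu> (s j)" by (rule prob)
    have "measure P (miss j) = measure (\<nu> (s j)) (q -` (- q ` K j))"
      unfolding miss_def by (rule transfer[OF that])
    also have "\<dots> \<le> measure (\<nu> (s j)) (- K j)"
      using sets.compl_sets[OF Ks[of j j]]
      by (intro finite_measure_mono) (auto simp: sp Compl_eq_Diff_UNIV)
    also note K(2)
    finally show ?thesis .
  qed
  have K_ne: "K j \<noteq> {}" for j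
  proof
    assume "K j = {}"
    then have "1 \<le> \<epsilon> * (1 / 2) ^ Suc j"
      using K(2)[of j] prob_space.prob_space[OF prob[of j]] by (simp add: sp)
    also have "\<dots> \<le> \<epsilon>" using \<epsilon> by (intro mult_half_power_le) simp
    finally show False using \<epsilon> by simp
  qed
  define B where "B = ?bad \<union> (\<Union>j<n. miss j)"
  have "measure P B \<le> measure P ?bad + measure P (\<Union>j<n. miss j)"
    unfolding B_def by (rule measure_Un_le) simp_all
  also have "measure P (\<Union>j<n. miss j) \<le> (\<Sum>j<n. measure P (miss j))"
    by (rule measure_UNION_le) simp_all
  also have "\<dots> \<le> (\<Sum>j<n. \<epsilon> * (1 / 2) ^ Suc j)" by (intro sum_mono miss) simp
  also have "\<dots> \<le> \<epsilon>"
    using sum_halves_le[of n] \<epsilon> unfolding sum_distrib_left[symmetric] by (intro mult_left_le) auto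
  finally have PB: "measure P B \<le> 2 * \<epsilon>" using bad by simp
  define S where "S = (\<lambda>f. f m) ` (- B)"
  have sub: "q -` S \<inter> K m \<subseteq> (\<lambda>x. x m) ` approx_chains K s n"
  proof
    fix y assume y: "y \<in> q -` S \<inter> K m"
    then obtain f where f: "f \<notin> B" "q y = f m" by (auto simp: S_def)
    have "\<exists>z. z \<in> K j \<and> (j < n \<longrightarrow> q z = f j)" for j
    proof (cases "j < n")
      case True
      then have "f \<notin> miss j" using f by (auto simp: B_def)
      then show ?thesis by (auto simp: miss_def)
    qed (use K_ne in auto)
    then obtain z where z: "\<And>j. z j \<in> K j" "\<And>j. j < n \<Longrightarrow> q (z j) = f j" by metis
    define x where "x = z(m := y)"
    have xK: "x j \<in> K j" for j using y z by (simp add: x_def)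
    have xq: "q (x j) = f j" if "j < n" for j using z f that by (simp add: x_def)
    have close: "dist (x j) (c (f j)) < \<delta>" if "j < n" for j
      using c[of "x j"] xq[OF that] by simp
    have "dist (x i) (x j) \<le> \<bar>s i - s j\<bar> * dist (x 0) (x 1) + inverse (Suc n)" if ij: "i < n" "j < n" for i j
    proof -
      have 1: "dist (x i) (x j) \<le> dist (c (f i)) (c (f j)) + 2 * \<delta>"
        using close[OF ij(1)] close[OF ij(2)] by metric
      have 2: "dist (c (f i)) (c (f j)) \<le> \<bar>s i - s j\<bar> * dist (c (f 0)) (c (f 1)) + e"
      proof (rule ccontr)
        assume "\<not> ?thesis"
        then have "f \<in> ?bad" using ij unfolding not_le by blast
        then have "f \<in> B" unfolding B_def by (rule UnI1)
        with f(1) show False by contradiction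
      qed
      have "0 < n" "1 < n" using n by auto
      then have 3: "dist (c (f 0)) (c (f 1)) \<le> dist (x 0) (x 1) + 2 * \<delta>"
        using close[of 0] close[of 1] by metric
      have "\<bar>s i - s j\<bar> \<le> 1" using s(3)[of i] s(3)[of j] by auto
      then have "\<bar>s i - s j\<bar> * (2 * \<delta>) \<le> 2 * \<delta>" using \<delta> by (intro mult_left_le_one_le) auto
      moreover have "\<bar>s i - s j\<bar> * dist (c (f 0)) (c (f 1)) \<le> \<bar>s i - s j\<bar> * (dist (x 0) (x 1) + 2 * \<delta>)"
        using 3 by (intro mult_left_mono) auto
      ultimately have "dist (x i) (x j) \<le> \<bar>s i - s j\<bar> * dist (x 0) (x 1) + 2 * \<delta> + e + 2 * \<delta>"
        using 1 2 by (simp add: distrib_left)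
      also have "\<dots> \<le> \<bar>s i - s j\<bar> * dist (x 0) (x 1) + 5 * e" using \<delta> by simp
      finally show ?thesis by (simp add: e_def)
    qed
    then have "x \<in> approx_chains K s n" using xK by (simp add: approx_chains_def)
    moreover have "x m = y" by (simp add: x_def)
    ultimately show "y \<in> (\<lambda>x. x m) ` approx_chains K s n" by blast
  qed
  interpret prob_space "\<nu> (s m)" by (rule prob)
  have "1 - 2 * \<epsilon> \<le> measure P (- B)"
    using PB measure_pmf.prob_compl[of B P] by (simp add: Compl_eq_Diff_UNIV)
  also have "\<dots> \<le> measure P {f. f m \<in> S}"
    by (intro measure_pmf.finite_measure_mono) (auto simp: S_def)
  also have "\<dots> = measure (\<nu> (s m)) (q -` S)" by (rule transfer[OF m])
  also have "\<dots> \<le> measure (\<nu> (s m)) (q -` S \<inter> K m) + measure (\<nu> (s m)) (- K m)"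
  proof -
    have "measure (\<nu> (s m)) (q -` S) \<le> measure (\<nu> (s m)) ((q -` S \<inter> K m) \<union> (- K m))"
      using vimage[of S m] Ks[of m m] sets.compl_sets[OF Ks[of m m]]
      by (intro finite_measure_mono) (auto simp: sp Compl_eq_Diff_UNIV)
    also have "\<dots> \<le> measure (\<nu> (s m)) (q -` S \<inter> K m) + measure (\<nu> (s m)) (- K m)"
      using vimage[of S m] Ks[of m m] sets.compl_sets[OF Ks[of m m]]
      by (intro measure_Un_le) (auto simp: sp Compl_eq_Diff_UNIV)
    finally show ?thesis .
  qed
  also have "measure (\<nu> (s m)) (- K m) \<le> \<epsilon>"
  proof -
    have "\<epsilon> * (1 / 2) ^ Suc m \<le> \<epsilon>" using \<epsilon> by (intro mult_half_power_le) simp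
    then show ?thesis using K(2)[of m] by linarith
  qed
  also have "measure (\<nu> (s m)) (q -` S \<inter> K m) \<le> measure (\<nu> (s m)) ((\<lambda>x. x m) ` approx_chains K s n)"
  proof (rule finite_measure_mono[OF sub])
    have "compact ((\<lambda>x. x m) ` approx_chains K s n)"
      by (intro compact_continuous_image compact_approx_chains K(1)
          continuous_on_subset[OF continuous_on_product_coordinates]) simp
    then show "(\<lambda>x. x m) ` approx_chains K s n \<in> events"
      by (simp add: sets borel_closed compact_imp_closed)
  qed
  finally show ?thesis by simp
qed

text \<open>
  The supporting compact sets at times \<open>0\<close> and \<open>1\<close> are chosen inside \<open>A\<^sub>0\<close> and \<open>A\<^sub>1\<close>, so the limiting geodesics join
  these sets. The compact projections \<open>T n\<close> decrease to a subset of \<open>B\<close>; passing to the limit through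
  them avoids all questions about the measurability of the set of intermediate points.
\<close>

lemma full_mass_of_intermediate_points:
  fixes \<nu> :: "real \<Rightarrow> 'a::polish_space measure"
  assumes geo: "constant_speed_geodesic W2 \<nu>" and P2: "\<And>t. t \<in> {0..1} \<Longrightarrow> \<nu> t \<in> P2"
    and A: "A\<^sub>0 \<in> sets borel" "A\<^sub>1 \<in> sets borel" "measure (\<nu> 0) A\<^sub>0 = 1" "measure (\<nu> 1) A\<^sub>1 = 1"
    and t: "t \<in> {0..1}" and B: "B \<in> sets borel" "intermediate_points A\<^sub>0 A\<^sub>1 t \<subseteq> B"
  shows "measure (\<nu> t) B = 1"
proof -
  interpret prob_space "\<nu> t" using P2_D[OF P2[OF t]] by simp
  have sets_t: "sets (\<nu> t) = sets borel" using P2_D[OF P2[OF t]] by simp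
  obtain s :: "nat \<Rightarrow> real" where s: "s 0 = 0" "s 1 = 1" "s 2 = t" "{0..1} \<subseteq> closure (range s)" "range s \<subseteq> {0..1}"
    by (rule ex_dense_times[OF t])
  have s01: "s j \<in> {0..1}" for j by (rule subsetD[OF s(5) rangeI])
  have prob: "prob_space (\<nu> (s j))" and sets: "sets (\<nu> (s j)) = sets borel" for j
    using P2_D[OF P2[OF s01]] by simp_all
  have bound: "1 - 3 * \<epsilon> \<le> measure (\<nu> t) B" if \<epsilon>: "0 < \<epsilon>" "\<epsilon> < 1" for \<epsilon>
  proof -
    define C where "C j = (if j = 0 then A\<^sub>0 else if j = 1 then A\<^sub>1 else UNIV)" for j :: nat
    have C: "C j \<in> sets borel" "measure (\<nu> (s j)) (C j) = 1" for j
    proof -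
      show "C j \<in> sets borel" using A(1,2) by (simp add: C_def)
      have "measure (\<nu> (s j)) UNIV = 1"
        using prob_space.prob_space[OF prob[of j]] sets_eq_imp_space_eq[OF sets[of j]] by simp
      moreover have "measure (\<nu> (s 0)) A\<^sub>0 = 1" "measure (\<nu> (s 1)) A\<^sub>1 = 1"
        using A(3,4) unfolding s(1,2) by simp_all
      ultimately show "measure (\<nu> (s j)) (C j) = 1"
        by (simp add: C_def)
    qed
    have "\<exists>K. compact K \<and> K \<subseteq> C j \<and> measure (\<nu> (s j)) (- K) \<le> \<epsilon> * (1 / 2) ^ Suc j" for j
    proof -
      have "0 < \<epsilon> * (1 / 2) ^ Suc j" using \<epsilon> by simp
      from inner_compact_full_measure[OF prob sets C this] show ?thesis by blast
    qed
    then obtain K where K: "\<And>j. compact (K j)" "\<And>j. K j \<subseteq> C j"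
      "\<And>j. measure (\<nu> (s j)) (- K j) \<le> \<epsilon> * (1 / 2) ^ Suc j"
      by metis
    define T where "T n = (\<lambda>x. x 2) ` approx_chains K s n" for n
    have T_bound: "1 - 3 * \<epsilon> \<le> measure (\<nu> t) (T n)" if "3 \<le> n" for n
      using projection_approx_chains_mass[OF geo P2 s(1,2) s01 K(1,3) \<epsilon>, of 2 n] that
      by (simp add: s(3) T_def)
    have "compact (T n)" for n
      unfolding T_def by (intro compact_continuous_image compact_approx_chains K(1)
          continuous_on_subset[OF continuous_on_product_coordinates]) simp
    then have "range T \<subseteq> events"
      by (auto simp: sets_t borel_closed compact_imp_closed)
    moreover have "decseq T"
      unfolding decseq_def T_def by (intro allI impI image_mono approx_chains_mono)
    ultimately have "(\<lambda>n. measure (\<nu> t) (T n)) \<longlonglongrightarrow> measure (\<nu> t) (\<Inter>n. T n)"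
      by (rule finite_Lim_measure_decseq)
    then have "1 - 3 * \<epsilon> \<le> measure (\<nu> t) (\<Inter>n. T n)"
      by (rule LIMSEQ_le_const) (use T_bound in blast)
    also have "\<dots> \<le> measure (\<nu> t) B"
    proof (rule finite_measure_mono)
      show "(\<Inter>n. T n) \<subseteq> B"
      proof
        fix y assume "y \<in> (\<Inter>n. T n)"
        then have y: "y \<in> (\<lambda>x. x 2) ` approx_chains K s n" for n by (simp add: T_def)
        obtain x where x: "x 2 = y" "\<And>j. x j \<in> K j"
          "\<And>i j. dist (x i) (x j) \<le> \<bar>s i - s j\<bar> * dist (x 0) (x 1)"
          by (rule Inter_projection_approx_chains[OF K(1) y]) (rule that; (assumption | simp))
        obtain \<gamma> where \<gamma>: "\<gamma> \<in> geodesics" "\<And>i. \<gamma> (s i) = x i"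
          using geodesic_through_dense_times[of s x, OF s(1,2,4,5) x(3)] by blast
        have "x 0 \<in> A\<^sub>0" "x 1 \<in> A\<^sub>1" using x(2)[of 0] x(2)[of 1] K(2)[of 0] K(2)[of 1] by (auto simp: C_def)
        then have "\<gamma> \<in> geodesics_between A\<^sub>0 A\<^sub>1"
          using \<gamma>(1) \<gamma>(2)[of 0] \<gamma>(2)[of 1] s by (simp add: geodesics_between_def)
        moreover have "\<gamma> t = y" using \<gamma>(2)[of 2] s(3) x(1) by simp
        ultimately have "y \<in> intermediate_points A\<^sub>0 A\<^sub>1 t" unfolding intermediate_points_def by blast
        then show "y \<in> B" using B(2) by blast
      qed
    qed (simp add: sets_t B)
    finally show ?thesis .
  qed
  have "1 \<le> measure (\<nu> t) B + e" if "0 < e" for e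
  proof -
    define \<epsilon> where "\<epsilon> = min (e / 3) (1 / 2)"
    have "0 < \<epsilon>" "\<epsilon> < 1" "3 * \<epsilon> \<le> e" using that by (auto simp: \<epsilon>_def)
    then show ?thesis using bound[of \<epsilon>] by simp
  qed
  then have "1 \<le> measure (\<nu> t) B" by (rule field_le_epsilon)
  then show ?thesis using prob_le_1[of B] by linarith
qed

section \<open>Endpoints of dynamical couplings\<close>

text \<open>
  Membership in the ambient function space makes the sup-distance on geodesics a genuine one, so that it dominates
  pointwise distances.
\<close>

lemma geodesic_in_cfunspace:
  fixes \<gamma> :: "real \<Rightarrow> 'a::metric_space"
  assumes "\<gamma> \<in> geodesics"
  shows "\<gamma> \<in> mspace (cfunspace (top_of_set {0..1}) euclidean_metric)"
proof -
  have g: "dist (\<gamma> s) (\<gamma> t) = \<bar>s - t\<bar> * dist (\<gamma> 0) (\<gamma> 1)" if "s \<in> {0..1}" "t \<in> {0..1}" for s t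
    using assms that unfolding geodesics_def constant_speed_geodesic_def by blast
  have "(dist (\<gamma> 0) (\<gamma> 1))-lipschitz_on {0..1} \<gamma>"
    by (rule lipschitz_onI) (use g in \<open>auto simp only: dist_real_def mult.commute zero_le_dist order_refl\<close>)
  then have "continuous_on {0..1} \<gamma>" by (rule lipschitz_on_continuous_on)
  moreover have "compactin (top_of_set {0..1::real}) (topspace (top_of_set {0..1}))"
    by (simp add: compactin_subtopology)
  ultimately show ?thesis
    using assms unfolding compactin_mspace_cfunspace[OF \<open>compactin _ _\<close>]
    by (simp add: geodesics_def)
qed

lemma space_geodesic_borel: "space geodesic_borel = geodesics"
  by (simp add: geodesic_borel_def space_measure_of_conv)

text \<open>
  Evaluation at a fixed time is \<open>1\<close>-Lipschitz for the sup-distance.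
\<close>

lemma measurable_evaluation:
  fixes s :: real
  assumes s: "s \<in> {0..1}"
  shows "(\<lambda>\<gamma>. \<gamma> s) \<in> measurable geodesic_borel (borel :: 'a::metric_space measure)"
proof (rule borel_measurableI)
  fix S :: "'a set" assume S: "open S"
  interpret Metric_space "mspace geodesic_metric" "mdist (geodesic_metric :: (real \<Rightarrow> 'a) metric)"
    by (rule Metric_space_mspace_mdist)
  let ?C = "cfunspace (top_of_set {0..1}) (euclidean_metric :: 'a metric)"
  have msp: "mspace (geodesic_metric :: (real \<Rightarrow> 'a) metric) = geodesics"
    using geodesic_in_cfunspace unfolding geodesic_metric_def mspace_submetric by blast
  have md: "mdist (geodesic_metric :: (real \<Rightarrow> 'a) metric) = mdist ?C"
    by (simp add: geodesic_metric_def)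
  have "openin (mtopology_of geodesic_metric) {\<gamma> \<in> geodesics. \<gamma> s \<in> S}"
    unfolding mtopology_of_def openin_mtopology
  proof (intro conjI allI impI)
    show "{\<gamma> \<in> geodesics. \<gamma> s \<in> S} \<subseteq> mspace geodesic_metric" by (auto simp: msp)
    fix \<gamma> assume \<gamma>: "\<gamma> \<in> {\<gamma> \<in> geodesics. \<gamma> s \<in> S}"
    then obtain r where r: "0 < r" "ball (\<gamma> s) r \<subseteq> S" using S by (auto simp: open_contains_ball)
    have "mball \<gamma> r \<subseteq> {\<gamma> \<in> geodesics. \<gamma> s \<in> S}"
    proof
      fix \<eta> assume "\<eta> \<in> mball \<gamma> r"
      then have "\<eta> \<in> mspace geodesic_metric \<and> mdist geodesic_metric \<gamma> \<eta> < r" by (simp only: in_mball)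
      then have \<eta>: "\<eta> \<in> geodesics" "mdist ?C \<gamma> \<eta> < r" by (simp_all add: msp md)
      have "mdist euclidean_metric (\<gamma> s) (\<eta> s) \<le> mdist ?C \<gamma> \<eta>"
        using \<gamma> \<eta> s geodesic_in_cfunspace by (intro mdist_cfunspace_imp_mdist_le[OF _ _ order_refl]) auto
      then have "\<eta> s \<in> ball (\<gamma> s) r" using \<eta>(2) by simp
      then show "\<eta> \<in> {\<gamma> \<in> geodesics. \<gamma> s \<in> S}" using r(2) \<eta>(1) by blast
    qed
    then show "\<exists>r>0. mball \<gamma> r \<subseteq> {\<gamma> \<in> geodesics. \<gamma> s \<in> S}" using r(1) by blast
  qed
  moreover have "{U. openin (mtopology_of geodesic_metric) U} \<subseteq> Pow (geodesics :: (real \<Rightarrow> 'a) set)"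
    using openin_subset[of "mtopology_of (geodesic_metric :: (real \<Rightarrow> 'a) metric)"]
    unfolding topspace_mtopology_of msp by blast
  ultimately have "{\<gamma> \<in> geodesics. \<gamma> s \<in> S} \<in> sets geodesic_borel"
    unfolding geodesic_borel_def by (simp add: sigma_sets.Basic)
  also have "{\<gamma> \<in> geodesics. \<gamma> s \<in> S} = (\<lambda>\<gamma>. \<gamma> s) -` S \<inter> space geodesic_borel"
    by (auto simp: space_geodesic_borel)
  finally show "(\<lambda>\<gamma>. \<gamma> s) -` S \<inter> space geodesic_borel \<in> sets geodesic_borel" .
qed

lemma dynamical_optimal_coupling_endpoints:
  fixes \<mu> \<nu> :: "'a::polish_space measure"
  assumes \<Theta>: "dynamical_optimal_coupling \<Theta> \<mu> \<nu>" and A: "A \<in> sets borel" "AE x in \<mu>. x \<in> A"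
    and B: "B \<in> sets borel" "AE x in \<nu>. x \<in> B"
  shows "AE \<gamma> in \<Theta>. \<gamma> \<in> geodesics_between A B"
proof -
  have sets: "sets \<Theta> = sets geodesic_borel" using \<Theta> by (simp add: dynamical_optimal_coupling_def)
  have meas: "(\<lambda>\<gamma>. \<gamma> s) \<in> measurable \<Theta> borel" if "s \<in> {0..1}" for s :: real
    using measurable_evaluation[OF that] measurable_cong_sets[OF sets refl] by auto
  have pair: "(\<lambda>\<gamma>. (\<gamma> 0, \<gamma> 1)) \<in> measurable \<Theta> (borel :: ('a \<times> 'a) measure)"
    using measurable_Pair[OF meas[of 0] meas[of 1]] unfolding borel_prod by simp
  have c: "distr \<Theta> borel (\<lambda>\<gamma>. (\<gamma> 0, \<gamma> 1)) \<in> couplings \<mu> \<nu>"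
    using \<Theta> by (simp add: dynamical_optimal_coupling_def optimal_coupling_def)
  have d0: "distr \<Theta> borel (\<lambda>\<gamma>. \<gamma> 0) = \<mu>" and d1: "distr \<Theta> borel (\<lambda>\<gamma>. \<gamma> 1) = \<nu>"
  proof -
    have "distr (distr \<Theta> borel (\<lambda>\<gamma>. (\<gamma> 0, \<gamma> 1))) borel fst = distr \<Theta> borel (\<lambda>\<gamma>. \<gamma> 0)"
      by (subst distr_distr[OF borel_measurable_continuous_onI pair]) (auto simp: o_def intro: continuous_intros)
    moreover have "distr (distr \<Theta> borel (\<lambda>\<gamma>. (\<gamma> 0, \<gamma> 1))) borel snd = distr \<Theta> borel (\<lambda>\<gamma>. \<gamma> 1)"
      by (subst distr_distr[OF borel_measurable_continuous_onI pair]) (auto simp: o_def intro: continuous_intros)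
    ultimately show "distr \<Theta> borel (\<lambda>\<gamma>. \<gamma> 0) = \<mu>" "distr \<Theta> borel (\<lambda>\<gamma>. \<gamma> 1) = \<nu>"
      using c unfolding couplings_def by auto
  qed
  have "AE \<gamma> in \<Theta>. \<gamma> 0 \<in> A"
    using A(2) unfolding d0[symmetric] by (subst (asm) AE_distr_iff[OF meas]) (use A(1) in auto)
  moreover have "AE \<gamma> in \<Theta>. \<gamma> 1 \<in> B"
    using B(2) unfolding d1[symmetric] by (subst (asm) AE_distr_iff[OF meas]) (use B(1) in auto)
  moreover have "AE \<gamma> in \<Theta>. \<gamma> \<in> geodesics"
    using sets_eq_imp_space_eq[OF sets] by (intro AE_I2) (simp add: space_geodesic_borel)
  ultimately show ?thesis by eventually_elim (simp add: geodesics_between_def)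
qed

section \<open>Entropy and uniform distributions\<close>

text \<open>
  The open sets of finite mass cover the space, and countably many of them suffice by the Lindelof property.
\<close>

lemma metric_measure_space_sigma_finite:
  fixes M :: "'a::polish_space measure"
  assumes "metric_measure_space M"
  shows "sigma_finite_measure M"
proof -
  have sets: "sets M = sets borel" using assms by (simp add: metric_measure_space_def)
  define F where "F = {S. open S \<and> emeasure M S < top}"
  obtain F' where F': "F' \<subseteq> F" "countable F'" "\<Union>F' = \<Union>F"
    using Lindelof[of F] by (auto simp: F_def)
  have "x \<in> \<Union>F" for x
  proof -
    obtain r where "0 < r" "emeasure M (ball x r) < top"
      using assms unfolding metric_measure_space_def by blast
    then show ?thesis unfolding F_def by (intro UnionI[of "ball x r"]) auto
  qed
  then have "\<Union>F' = space M" using F'(3) sets_eq_imp_space_eq[OF sets] by auto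
  moreover have "F' \<subseteq> sets M" "\<forall>a\<in>F'. emeasure M a \<noteq> \<infinity>"
    using F'(1) by (auto simp: F_def sets)
  ultimately show ?thesis using F'(2) unfolding sigma_finite_measure_def by blast
qed

lemma epow_mono:
  assumes "x \<le> y" "0 < a"
  shows "epow x a \<le> epow y a"
proof (cases "y = top")
  case True
  then show ?thesis using assms by (simp add: epow_def)
next
  case False
  then have "x \<noteq> top" using assms(1) by (auto simp: top_unique)
  moreover have "enn2real x powr a \<le> enn2real y powr a"
    using assms False by (intro powr_mono2 enn2real_mono) (auto simp: less_top)
  ultimately show ?thesis using False assms by (simp add: epow_def ennreal_leI)
qed

text \<open>
  Jensen's inequality for the concave power \<open>r powr (1 - 1/N)\<close> on a set \<open>B\<close> of full mass. It is proved by integrating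
  the tangent line at \<open>1 / m(B)\<close>, the value of the density that is uniform on \<open>B\<close>.
\<close>

lemma entropy_lower_bound:
  assumes "sigma_finite_measure M" and \<nu>: "prob_space \<nu>" "sets \<nu> = sets M" "absolutely_continuous M \<nu>"
    and B: "B \<in> sets M" "measure \<nu> B = 1" and N: "1 \<le> N"
  shows "- enn2ereal (epow (emeasure M B) (1 / N)) \<le> S_ent M N \<nu>"
proof -
  interpret M: sigma_finite_measure M by fact
  interpret P: prob_space \<nu> by fact
  have sp: "space \<nu> = space M" using \<nu>(2) by (rule sets_eq_imp_space_eq)
  define \<rho> where "\<rho> = (SOME \<rho>. \<exists>\<nu>\<^sub>s. lebesgue_decomposition M \<nu> \<rho> \<nu>\<^sub>s)"
  have "lebesgue_decomposition M \<nu> (RN_deriv M \<nu>) (null_measure M)"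
    unfolding lebesgue_decomposition_def using M.density_RN_deriv[OF \<nu>(3,2)] by auto
  then have "\<exists>\<nu>\<^sub>s. lebesgue_decomposition M \<nu> \<rho> \<nu>\<^sub>s"
    unfolding \<rho>_def by (intro someI[of "\<lambda>\<rho>. \<exists>\<nu>\<^sub>s. lebesgue_decomposition M \<nu> \<rho> \<nu>\<^sub>s"]) blast
  then obtain \<nu>\<^sub>s where dec: "lebesgue_decomposition M \<nu> \<rho> \<nu>\<^sub>s" by blast
  have \<rho>[measurable]: "\<rho> \<in> borel_measurable M" using dec by (simp add: lebesgue_decomposition_def)
  have le: "(\<integral>\<^sup>+ x. \<rho> x * indicator A x \<partial>M) \<le> emeasure \<nu> A" if "A \<in> sets M" for A
    using dec that by (simp add: lebesgue_decomposition_def emeasure_density)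
  have total: "(\<integral>\<^sup>+ x. \<rho> x \<partial>M) \<le> 1"
  proof -
    have "(\<integral>\<^sup>+ x. \<rho> x \<partial>M) = (\<integral>\<^sup>+ x. \<rho> x * indicator (space M) x \<partial>M)"
      by (intro nn_integral_cong) simp
    also have "\<dots> \<le> 1" using le[of "space M"] P.emeasure_space_1 by (simp add: sp)
    finally show ?thesis .
  qed
  have off: "AE x in M. x \<notin> B \<longrightarrow> \<rho> x = 0"
  proof -
    have "emeasure \<nu> (space M - B) = 0"
      using P.prob_compl[of B] B by (simp add: sp \<nu>(2) P.emeasure_eq_measure)
    then have "(\<integral>\<^sup>+ x. \<rho> x * indicator (space M - B) x \<partial>M) = 0"
      using le[of "space M - B"] B by simp
    then have "AE x in M. \<rho> x * indicator (space M - B) x = 0"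
      using B by (subst (asm) nn_integral_0_iff_AE) simp_all
    then show ?thesis by (rule AE_mp) (rule AE_I2, auto simp: indicator_def)
  qed
  have fin: "AE x in M. \<rho> x \<noteq> \<infinity>"
    using total by (intro nn_integral_PInf_AE) (auto simp: top_unique)
  have main: "(\<integral>\<^sup>+ x. epow (\<rho> x) (1 - 1 / N) \<partial>M) \<le> epow (emeasure M B) (1 / N)"
  proof (cases "emeasure M B = top")
    case True
    then show ?thesis using N by (simp add: epow_def)
  next
    case False
    define b where "b = measure M B"
    have Mb: "emeasure M B = ennreal b" using False by (simp add: b_def emeasure_eq_ennreal_measure)
    have "b \<noteq> 0"
    proof
      assume "b = 0"
      then have "B \<in> null_sets M" using B Mb by (auto simp: null_sets_def)
      then have "emeasure \<nu> B = 0" using \<nu>(3) by (auto simp: absolutely_continuous_def)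
      then show False using B(2) by (simp add: measure_def)
    qed
    then have b: "0 < b" by (simp add: b_def less_le)
    define \<alpha> where "\<alpha> = 1 - 1 / N"
    have \<alpha>: "0 \<le> \<alpha>" "0 < 1 / N" "\<alpha> + 1 / N = 1" using N by (simp_all add: \<alpha>_def)
    \<comment> \<open>The tangent line to \<open>r powr \<alpha>\<close> at \<open>1 / b\<close>, in the form given by Young's inequality.\<close>
    have young: "r powr \<alpha> \<le> b powr (1 / N) * (\<alpha> * r + 1 / N / b)" if r: "0 < r" for r
    proof -
      have "r powr \<alpha> * (1 / b) powr (1 / N) \<le> \<alpha> * r + 1 / N * (1 / b)"
        using r b \<alpha> by (intro Youngs_inequality_0) auto
      then have "b powr (1 / N) * (r powr \<alpha> * (1 / b) powr (1 / N)) \<le> b powr (1 / N) * (\<alpha> * r + 1 / N / b)"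
        by (intro mult_left_mono) auto
      moreover have "b powr (1 / N) * (1 / b) powr (1 / N) = 1"
        using b by (simp add: powr_mult[symmetric])
      ultimately show ?thesis by (simp add: mult.left_commute)
    qed
    have "(\<integral>\<^sup>+ x. epow (\<rho> x) (1 - 1 / N) \<partial>M) \<le>
        (\<integral>\<^sup>+ x. ennreal (b powr (1 / N)) * (ennreal \<alpha> * \<rho> x + ennreal (1 / N / b) * indicator B x) \<partial>M)"
    proof (rule nn_integral_mono_AE)
      show "AE x in M. epow (\<rho> x) (1 - 1 / N) \<le>
          ennreal (b powr (1 / N)) * (ennreal \<alpha> * \<rho> x + ennreal (1 / N / b) * indicator B x)"
        using off fin
      proof eventually_elim
        case (elim x)
        show ?case
        proof (cases "\<rho> x = 0")
          case True
          then show ?thesis using \<alpha> by (simp add: epow_def \<alpha>_def[symmetric])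
        next
          case False
          then have x: "x \<in> B" using elim by auto
          obtain r where r: "\<rho> x = ennreal r" "0 < r"
            using elim(2) False by (cases "\<rho> x") (auto simp: less_le)
          have "epow (\<rho> x) (1 - 1 / N) = ennreal (r powr \<alpha>)"
            using r \<alpha> by (simp add: epow_def \<alpha>_def[symmetric])
          also have "\<dots> \<le> ennreal (b powr (1 / N) * (\<alpha> * r + 1 / N / b))"
            by (intro ennreal_leI young r)
          also have "\<dots> = ennreal (b powr (1 / N)) * (ennreal \<alpha> * \<rho> x + ennreal (1 / N / b) * indicator B x)"
            using \<alpha> b r x by (simp add: ennreal_mult' ennreal_plus)
          finally show ?thesis .
        qed
      qed
    qed
    also have "\<dots> = ennreal (b powr (1 / N)) * (ennreal \<alpha> * (\<integral>\<^sup>+ x. \<rho> x \<partial>M) + ennreal (1 / N / b) * emeasure M B)"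
      using B by (simp add: nn_integral_cmult nn_integral_add)
    also have "\<dots> \<le> ennreal (b powr (1 / N)) * (ennreal \<alpha> * 1 + ennreal (1 / N / b) * ennreal b)"
      unfolding Mb by (intro mult_left_mono add_right_mono total) auto
    also have "ennreal \<alpha> * 1 + ennreal (1 / N / b) * ennreal b = 1"
    proof -
      have "ennreal (1 / N / b) * ennreal b = ennreal (1 / N)"
        using \<alpha> b by (simp add: ennreal_mult'[symmetric])
      then have "ennreal \<alpha> * 1 + ennreal (1 / N / b) * ennreal b = ennreal (\<alpha> + 1 / N)"
        using \<alpha>(1,2) by (simp only: mult_1_right) (simp add: ennreal_plus)
      then show ?thesis by (simp only: \<alpha>(3) ennreal_1)
    qed
    finally show ?thesis using b by (simp add: epow_def Mb)
  qed
  show ?thesis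
    unfolding S_ent_def \<rho>_def[symmetric] Let_def using main
    by (simp add: ereal_minus_le_minus less_eq_ennreal.rep_eq)
qed

lemma uniform_density_P2_ac:
  fixes M :: "'a::polish_space measure"
  assumes M: "sets M = sets borel" and A: "A \<in> sets borel" "bounded A" and a: "emeasure M A = ennreal a" "0 < a"
  defines "D \<equiv> density M (\<lambda>x. ennreal (1 / a) * indicator A x)"
  shows "D \<in> P2_ac M" "bounded (msupp D)" "measure D A = 1" "AE x in D. x \<in> A"
proof -
  have [measurable]: "A \<in> sets M" using A M by simp
  have sp: "space M = UNIV" using sets_eq_imp_space_eq[OF M] by simp
  have aa: "ennreal (1 / a) * ennreal a = 1"
    using a(2) by (simp add: ennreal_mult'[symmetric])
  have DA: "emeasure D S = ennreal (1 / a) * emeasure M (A \<inter> S)" if "S \<in> sets M" for S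
  proof -
    have "emeasure D S = (\<integral>\<^sup>+ x. ennreal (1 / a) * indicator (A \<inter> S) x \<partial>M)"
      unfolding D_def using that by (subst emeasure_density) (auto intro!: nn_integral_cong simp: indicator_def)
    also have "\<dots> = ennreal (1 / a) * emeasure M (A \<inter> S)"
      using that by (simp add: nn_integral_cmult)
    finally show ?thesis .
  qed
  have "emeasure D UNIV = 1" using DA[of UNIV] sets.top[of M] aa a(1) by (simp add: sp)
  then have prob: "prob_space D" by (intro prob_spaceI) (simp add: D_def sp)
  have setsD: "sets D = sets borel" by (simp add: D_def M)
  have mA: "emeasure D A = 1" using DA[of A] aa a(1) by simp
  then show "measure D A = 1" by (simp add: measure_def)
  show "AE x in D. x \<in> A"
    unfolding D_def by (subst AE_density) (auto simp: indicator_def)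
  have closed: "msupp D \<subseteq> closure A"
  proof (rule subsetI, rule ccontr)
    fix x assume x: "x \<in> msupp D" "x \<notin> closure A"
    have "A \<inter> (- closure A) = {}" using closure_subset[of A] by auto
    then have "emeasure D (- closure A) = 0" using DA[of "- closure A"] by (simp add: M)
    moreover have "open (- closure A)" by (simp add: open_Compl)
    ultimately show False using x unfolding msupp_def by (metis (mono_tags, lifting) ComplI less_irrefl mem_Collect_eq)
  qed
  then show "bounded (msupp D)" using A(2) bounded_closure bounded_subset by blast
  obtain x\<^sub>0 e where e: "\<And>y. y \<in> A \<Longrightarrow> dist x\<^sub>0 y \<le> e" using A(2) by (auto simp: bounded_def)
  have "(\<integral>\<^sup>+ x. ennreal ((dist x\<^sub>0 x)\<^sup>2) \<partial>D) \<le> (\<integral>\<^sup>+ x. ennreal (e\<^sup>2) \<partial>D)"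
  proof (rule nn_integral_mono_AE)
    show "AE x in D. ennreal ((dist x\<^sub>0 x)\<^sup>2) \<le> ennreal (e\<^sup>2)"
      using \<open>AE x in D. x \<in> A\<close> by eventually_elim (auto intro!: ennreal_leI power_mono e)
  qed
  also have "\<dots> < top" using prob_space.emeasure_space_1[OF prob] by simp
  finally have "D \<in> P2" using prob setsD by (auto simp: P2_def)
  moreover have "absolutely_continuous M D"
    unfolding D_def by (rule absolutely_continuousI_density) simp
  ultimately show "D \<in> P2_ac M" by (simp add: P2_ac_def)
qed

lemma epow_inverse:
  assumes "0 < a"
  shows "epow (ennreal (1 / a)) (- 1 / N) = epow (ennreal a) (1 / N)"
proof -
  have "(1 / a) powr (- (1 / N)) = a powr (1 / N)"
    using assms by (simp add: powr_minus powr_divide)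
  then show ?thesis using assms by (simp add: epow_def)
qed

section \<open>The Brunn-Minkowski inequality\<close>

text \<open>
  The curvature condition is applied to the uniform distributions on the two sets, with the exponent \<open>N\<close> itself. The
  constant formed with the infima lies below the integrand almost everywhere, and this bounds the integral from below
  without any discussion of the measurability of the coefficients along geodesics.
\<close>

lemma Brunn_Minkowski_finite_mass:
  fixes M :: "'a::polish_space measure"
  assumes mms: "metric_measure_space M" and N: "1 \<le> N" and CD: "CD M k N"
    and A: "A\<^sub>0 \<in> sets borel" "A\<^sub>1 \<in> sets borel" "bounded A\<^sub>0" "bounded A\<^sub>1"
    and pos: "0 < emeasure M A\<^sub>0" "0 < emeasure M A\<^sub>1"
    and fin: "emeasure M A\<^sub>0 < top" "emeasure M A\<^sub>1 < top" and t: "t \<in> {0..1}"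
  shows "(INF \<gamma>\<in>geodesics_between A\<^sub>0 A\<^sub>1. tau_coeff (1 - t) (k_minus k \<gamma>) N (speed \<gamma>))
             * epow (emeasure M A\<^sub>0) (1 / N)
         + (INF \<gamma>\<in>geodesics_between A\<^sub>0 A\<^sub>1. tau_coeff t (k_plus k \<gamma>) N (speed \<gamma>))
             * epow (emeasure M A\<^sub>1) (1 / N)
         \<le> epow (outer_measure_of M (intermediate_points A\<^sub>0 A\<^sub>1 t)) (1 / N)"
    (is "?I0 * ?m0 + ?I1 * ?m1 \<le> _")
proof -
  have sets: "sets M = sets borel" using mms by (simp add: metric_measure_space_def)
  have sp: "space M = UNIV" using sets_eq_imp_space_eq[OF sets] by simp
  interpret M: sigma_finite_measure M by (rule metric_measure_space_sigma_finite[OF mms])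
  define a b where "a = measure M A\<^sub>0" and "b = measure M A\<^sub>1"
  have a: "emeasure M A\<^sub>0 = ennreal a" "0 < a" and b: "emeasure M A\<^sub>1 = ennreal b" "0 < b"
  proof -
    show "emeasure M A\<^sub>0 = ennreal a" "emeasure M A\<^sub>1 = ennreal b"
      unfolding a_def b_def using fin by (auto intro: emeasure_eq_ennreal_measure)
    then show "0 < a" "0 < b" using pos by simp_all
  qed
  define \<rho>\<^sub>0 \<rho>\<^sub>1 :: "'a \<Rightarrow> ennreal" where "\<rho>\<^sub>0 x = ennreal (1 / a) * indicator A\<^sub>0 x"
    and "\<rho>\<^sub>1 x = ennreal (1 / b) * indicator A\<^sub>1 x" for x
  note D0 = uniform_density_P2_ac[OF sets A(1,3) a, folded \<rho>\<^sub>0_def]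
  note D1 = uniform_density_P2_ac[OF sets A(2,4) b, folded \<rho>\<^sub>1_def]
  have m0: "\<rho>\<^sub>0 \<in> borel_measurable M" and m1: "\<rho>\<^sub>1 \<in> borel_measurable M"
    unfolding \<rho>\<^sub>0_def \<rho>\<^sub>1_def using A sets by auto
  from CD[unfolded CD_def, THEN bspec, OF m0, THEN bspec, OF m1, THEN mp, OF D0(1), THEN mp, OF D1(1),
      THEN mp, OF D0(2), THEN mp, OF D1(2)]
  obtain \<Theta> \<nu> where
    \<Theta>: "dynamical_optimal_coupling \<Theta> (density M \<rho>\<^sub>0) (density M \<rho>\<^sub>1)"
    and geo: "constant_speed_geodesic W2 \<nu>" and P2: "\<forall>t\<in>{0..1}. \<nu> t \<in> P2_ac M"
    and ends: "\<nu> 0 = density M \<rho>\<^sub>0" "\<nu> 1 = density M \<rho>\<^sub>1"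
    and ent: "\<forall>t\<in>{0..1}. \<forall>N'\<ge>N. S_ent M N' (\<nu> t) \<le> - enn2ereal (\<integral>\<^sup>+ \<gamma>.
        (tau_coeff (1 - t) (k_minus k \<gamma>) N' (speed \<gamma>) * epow (\<rho>\<^sub>0 (\<gamma> 0)) (- 1 / N') +
         tau_coeff t (k_plus k \<gamma>) N' (speed \<gamma>) * epow (\<rho>\<^sub>1 (\<gamma> 1)) (- 1 / N')) \<partial>\<Theta>)"
    by (elim exE conjE) (rule that)
  let ?J = "\<integral>\<^sup>+ \<gamma>. (tau_coeff (1 - t) (k_minus k \<gamma>) N (speed \<gamma>) * epow (\<rho>\<^sub>0 (\<gamma> 0)) (- 1 / N) +
         tau_coeff t (k_plus k \<gamma>) N (speed \<gamma>) * epow (\<rho>\<^sub>1 (\<gamma> 1)) (- 1 / N)) \<partial>\<Theta>"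
  obtain B where B: "B \<in> sets M" "intermediate_points A\<^sub>0 A\<^sub>1 t \<subseteq> B"
    "outer_measure_of M (intermediate_points A\<^sub>0 A\<^sub>1 t) = emeasure M B"
    using outer_measure_of_attain[of "intermediate_points A\<^sub>0 A\<^sub>1 t" M] sp by auto
  have P2': "\<nu> s \<in> P2" "absolutely_continuous M (\<nu> s)" if "s \<in> {0..1}" for s
    using P2 that by (auto simp: P2_ac_def)
  have full: "measure (\<nu> t) B = 1"
    using B(1) sets by (intro full_mass_of_intermediate_points[OF geo P2'(1) A(1,2) _ _ t _ B(2)])
      (simp_all add: ends D0(3) D1(3))
  have "prob_space (\<nu> t)" "sets (\<nu> t) = sets M"
    using P2_D[OF P2'(1)[OF t]] sets by simp_all
  then have "- enn2ereal (epow (emeasure M B) (1 / N)) \<le> S_ent M N (\<nu> t)"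
    using P2'(2)[OF t] B(1) full N by (intro entropy_lower_bound M.sigma_finite_measure_axioms)
  also have "\<dots> \<le> - enn2ereal ?J" using ent t by blast
  finally have J: "?J \<le> epow (emeasure M B) (1 / N)"
    by (simp add: ereal_minus_le_minus less_eq_ennreal.rep_eq)
  interpret \<Theta>: prob_space \<Theta> using \<Theta> by (simp add: dynamical_optimal_coupling_def)
  have "?I0 * ?m0 + ?I1 * ?m1 = (\<integral>\<^sup>+ \<gamma>. ?I0 * ?m0 + ?I1 * ?m1 \<partial>\<Theta>)"
    by (simp add: \<Theta>.emeasure_space_1)
  also have "\<dots> \<le> ?J"
  proof (rule nn_integral_mono_AE)
    have "AE \<gamma> in \<Theta>. \<gamma> \<in> geodesics_between A\<^sub>0 A\<^sub>1"
      using \<Theta> A(1) D0(4) A(2) D1(4) by (rule dynamical_optimal_coupling_endpoints)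
    then show "AE \<gamma> in \<Theta>. ?I0 * ?m0 + ?I1 * ?m1 \<le>
        tau_coeff (1 - t) (k_minus k \<gamma>) N (speed \<gamma>) * epow (\<rho>\<^sub>0 (\<gamma> 0)) (- 1 / N) +
        tau_coeff t (k_plus k \<gamma>) N (speed \<gamma>) * epow (\<rho>\<^sub>1 (\<gamma> 1)) (- 1 / N)"
    proof eventually_elim
      case (elim \<gamma>)
      then have "\<rho>\<^sub>0 (\<gamma> 0) = ennreal (1 / a)" "\<rho>\<^sub>1 (\<gamma> 1) = ennreal (1 / b)"
        by (simp_all add: \<rho>\<^sub>0_def \<rho>\<^sub>1_def geodesics_between_def)
      then have e: "epow (\<rho>\<^sub>0 (\<gamma> 0)) (- 1 / N) = ?m0" "epow (\<rho>\<^sub>1 (\<gamma> 1)) (- 1 / N) = ?m1"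
        unfolding a(1) b(1) using epow_inverse[OF a(2)] epow_inverse[OF b(2)] by simp_all
      show ?case unfolding e by (intro add_mono mult_right_mono INF_lower elim) simp_all
    qed
  qed
  also note J
  finally show ?thesis unfolding B(3) .
qed

text \<open>
  A bounded set may a priori have infinite mass, because bounded sets need not be compact. The masses of the
  approximating sets are required to be positive so that they carry uniform distributions.
\<close>

lemma ex_finite_mass_exhaustion:
  assumes "sigma_finite_measure M" and A: "A \<in> sets M" "0 < emeasure M A" and a: "0 < a"
  obtains C :: "nat \<Rightarrow> 'a set" where "\<And>n. C n \<in> sets M" "\<And>n. C n \<subseteq> A"
    "\<And>n. 0 < emeasure M (C n)" "\<And>n. emeasure M (C n) < top"
    "incseq (\<lambda>n. epow (emeasure M (C n)) a)"
    "(SUP n. epow (emeasure M (C n)) a) = epow (emeasure M A) a"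
proof (cases "emeasure M A < top")
  case True
  show thesis by (rule that[of "\<lambda>_. A"]) (use A True in \<open>auto simp: incseq_def\<close>)
next
  case False
  then have top: "emeasure M A = top" using top.not_eq_extremum by blast
  interpret sigma_finite_measure M by fact
  obtain F :: "nat \<Rightarrow> 'a set" where F: "range F \<subseteq> sets M" "(\<Union>i. F i) = space M"
    "\<And>i. emeasure M (F i) \<noteq> \<infinity>" "incseq F"
    using sigma_finite_incseq by blast
  have Fs: "F n \<in> sets M" for n using F(1) by auto
  have "(SUP n. emeasure M (F n \<inter> A)) = emeasure M (\<Union>n. F n \<inter> A)"
    using F(4) Fs A(1) by (intro SUP_emeasure_incseq) (auto simp: incseq_def)
  also have "(\<Union>n. F n \<inter> A) = A" using F(2) sets.sets_into_space[OF A(1)] by auto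
  also note top
  finally have sup: "(SUP n. emeasure M (F n \<inter> A)) = top" .
  have large: "\<exists>n. x < emeasure M (F n \<inter> A)" if "x < top" for x
    using sup that unfolding SUP_eq_top_iff by blast
  obtain n\<^sub>0 where n\<^sub>0: "0 < emeasure M (F n\<^sub>0 \<inter> A)" using large[of 0] by auto
  define C where "C n = F (n + n\<^sub>0) \<inter> A" for n
  have mono: "emeasure M (F m \<inter> A) \<le> emeasure M (F n \<inter> A)" if "m \<le> n" for m n
    using F(4) that Fs A(1) by (intro emeasure_mono) (auto simp: incseq_def)
  show thesis
  proof (rule that[of C])
    show "C n \<in> sets M" "C n \<subseteq> A" for n using Fs A by (auto simp: C_def)
    show "0 < emeasure M (C n)" for n
      using n\<^sub>0 mono[of n\<^sub>0 "n + n\<^sub>0"] by (simp add: C_def order_less_le_trans)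
    show "emeasure M (C n) < top" for n
    proof -
      have "emeasure M (C n) \<le> emeasure M (F (n + n\<^sub>0))"
        unfolding C_def using Fs by (intro emeasure_mono) auto
      also have "\<dots> < top" using F(3)[of "n + n\<^sub>0"] unfolding infinity_ennreal_def top.not_eq_extremum .
      finally show ?thesis .
    qed
    show "incseq (\<lambda>n. epow (emeasure M (C n)) a)"
      unfolding incseq_def C_def using a by (intro allI impI epow_mono mono) simp_all
    have "(SUP n. epow (emeasure M (C n)) a) = top"
      unfolding SUP_eq_top_iff
    proof (intro allI impI)
      fix x :: ennreal assume "x < top"
      then obtain r where r: "x = ennreal r" "0 \<le> r" by (cases x) auto
      obtain n where n: "ennreal ((r + 1) powr (1 / a)) < emeasure M (F n \<inter> A)"
        using large[of "ennreal ((r + 1) powr (1 / a))"] by auto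
      have "x < ennreal (r + 1)" using r by (simp add: ennreal_less_iff)
      also have "\<dots> = epow (ennreal ((r + 1) powr (1 / a))) a"
        using a r by (simp add: epow_def powr_powr)
      also have "\<dots> \<le> epow (emeasure M (C n)) a"
        unfolding C_def using n mono[of n "n + n\<^sub>0"] a by (intro epow_mono) auto
      finally show "\<exists>n\<in>UNIV. x < epow (emeasure M (C n)) a" by blast
    qed
    also have "top = epow (emeasure M A) a" using a by (simp add: top epow_def)
    finally show "(SUP n. epow (emeasure M (C n)) a) = epow (emeasure M A) a" .
  qed
qed

lemma geodesics_between_mono: "A \<subseteq> A' \<Longrightarrow> B \<subseteq> B' \<Longrightarrow> geodesics_between A B \<subseteq> geodesics_between A' B'"
  by (auto simp: geodesics_between_def)

lemma intermediate_points_mono: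
  "A \<subseteq> A' \<Longrightarrow> B \<subseteq> B' \<Longrightarrow> intermediate_points A B t \<subseteq> intermediate_points A' B' t"
  unfolding intermediate_points_def using geodesics_between_mono by blast

theorem theorem5p1:
  fixes M :: "'a::polish_space measure" and k :: "'a \<Rightarrow> real" and N t :: real
    and A\<^sub>0 A\<^sub>1 :: "'a set"
  assumes "metric_measure_space M" and "msupp M = UNIV"
    and "lower_semicontinuous k" and "1 \<le> N" and "CD M k N"
    and "A\<^sub>0 \<in> sets borel" and "A\<^sub>1 \<in> sets borel" and "bounded A\<^sub>0" and "bounded A\<^sub>1"
    and "0 < emeasure M A\<^sub>0 * emeasure M A\<^sub>1"
    and "t \<in> {0..1}"
  shows "(INF \<gamma>\<in>geodesics_between A\<^sub>0 A\<^sub>1. tau_coeff (1 - t) (k_minus k \<gamma>) N (speed \<gamma>))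
             * epow (emeasure M A\<^sub>0) (1 / N)
         + (INF \<gamma>\<in>geodesics_between A\<^sub>0 A\<^sub>1. tau_coeff t (k_plus k \<gamma>) N (speed \<gamma>))
             * epow (emeasure M A\<^sub>1) (1 / N)
         \<le> epow (outer_measure_of M (intermediate_points A\<^sub>0 A\<^sub>1 t)) (1 / N)
       \<and> 0 \<le> (INF \<gamma>\<in>geodesics_between A\<^sub>0 A\<^sub>1. tau_coeff (1 - t) (k_minus k \<gamma>) N (speed \<gamma>))
       \<and> 0 \<le> (INF \<gamma>\<in>geodesics_between A\<^sub>0 A\<^sub>1. tau_coeff t (k_plus k \<gamma>) N (speed \<gamma>))"
proof (intro conjI)
  let ?I0 = "\<lambda>A B. INF \<gamma>\<in>geodesics_between A B. tau_coeff (1 - t) (k_minus k \<gamma>) N (speed \<gamma>)"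
  let ?I1 = "\<lambda>A B. INF \<gamma>\<in>geodesics_between A B. tau_coeff t (k_plus k \<gamma>) N (speed \<gamma>)"
  let ?m = "\<lambda>A. epow (emeasure M A) (1 / N)"
  let ?R = "epow (outer_measure_of M (intermediate_points A\<^sub>0 A\<^sub>1 t)) (1 / N)"
  have sets: "sets M = sets borel" using assms(1) by (simp add: metric_measure_space_def)
  note sf = metric_measure_space_sigma_finite[OF assms(1)]
  have pos: "0 < emeasure M A\<^sub>0" "0 < emeasure M A\<^sub>1"
    using assms(10) by (auto simp: zero_less_iff_neq_zero)
  have As: "A\<^sub>0 \<in> sets M" "A\<^sub>1 \<in> sets M" using assms(6,7) sets by simp_all
  have N: "0 < 1 / N" using assms(4) by simp
  obtain C where C: "\<And>n. C n \<in> sets M" "\<And>n. C n \<subseteq> A\<^sub>0" "\<And>n. 0 < emeasure M (C n)"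
    "\<And>n. emeasure M (C n) < top" "incseq (\<lambda>n. ?m (C n))" "(SUP n. ?m (C n)) = ?m A\<^sub>0"
    by (rule ex_finite_mass_exhaustion[OF sf As(1) pos(1) N]) (rule that; (assumption | simp))
  obtain D where D: "\<And>n. D n \<in> sets M" "\<And>n. D n \<subseteq> A\<^sub>1" "\<And>n. 0 < emeasure M (D n)"
    "\<And>n. emeasure M (D n) < top" "incseq (\<lambda>n. ?m (D n))" "(SUP n. ?m (D n)) = ?m A\<^sub>1"
    by (rule ex_finite_mass_exhaustion[OF sf As(2) pos(2) N]) (rule that; (assumption | simp))
  have "?I0 A\<^sub>0 A\<^sub>1 * ?m A\<^sub>0 + ?I1 A\<^sub>0 A\<^sub>1 * ?m A\<^sub>1 =
      (SUP n. ?I0 A\<^sub>0 A\<^sub>1 * ?m (C n)) + (SUP n. ?I1 A\<^sub>0 A\<^sub>1 * ?m (D n))"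
    unfolding C(6)[symmetric] D(6)[symmetric] SUP_mult_left_ennreal ..
  also have "\<dots> = (SUP n. ?I0 A\<^sub>0 A\<^sub>1 * ?m (C n) + ?I1 A\<^sub>0 A\<^sub>1 * ?m (D n))"
    using C(5) D(5) by (intro ennreal_SUP_add[symmetric]) (auto simp: incseq_def intro: mult_left_mono)
  also have "\<dots> \<le> ?R"
  proof (rule SUP_least)
    fix n
    have sub: "geodesics_between (C n) (D n) \<subseteq> geodesics_between A\<^sub>0 A\<^sub>1"
      by (rule geodesics_between_mono[OF C(2) D(2)])
    have "?I0 A\<^sub>0 A\<^sub>1 * ?m (C n) + ?I1 A\<^sub>0 A\<^sub>1 * ?m (D n) \<le>
        ?I0 (C n) (D n) * ?m (C n) + ?I1 (C n) (D n) * ?m (D n)"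
      by (intro add_mono mult_right_mono INF_superset_mono[OF sub]) simp_all
    also have "\<dots> \<le> epow (outer_measure_of M (intermediate_points (C n) (D n) t)) (1 / N)"
      using C(1,3,4) D(1,3,4) sets assms(1,4,5,8,9,11) bounded_subset[OF _ C(2)] bounded_subset[OF _ D(2)]
      by (intro Brunn_Minkowski_finite_mass) simp_all
    also have "\<dots> \<le> ?R"
      by (intro epow_mono outer_measure_of_mono intermediate_points_mono C(2) D(2) N)
    finally show "?I0 A\<^sub>0 A\<^sub>1 * ?m (C n) + ?I1 A\<^sub>0 A\<^sub>1 * ?m (D n) \<le> ?R" .
  qed
  finally show "?I0 A\<^sub>0 A\<^sub>1 * ?m A\<^sub>0 + ?I1 A\<^sub>0 A\<^sub>1 * ?m A\<^sub>1 \<le> ?R" .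
qed simp_all

end
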